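(* Let $r\ge 3$ and $k\ge 3$ be integers and let $G$ be a $\mathcal{G}_k^{(r)}$-free $r$-graph. Let $\mathcal{M}_1$, $\mathcal{M}_2$ and $\mathcal{M}'_2$ be as in the context. Suppose $F\in\mathcal{M}'_2$ satisfies Property $\mathbb{P}$. Then for every $S\in\mathcal{M}_1$ with $S\not\subseteq F$ such that $F\cup S\in\mathcal{M}'_2$, we have $|S|=2$, and $F\cup S$ also satisfies Property $\mathbb{P}$.
   Context: An $r$-graph is identified with its edge set; $|H|$ is its number of edges and $V(H)=\bigcup_{e\in H}e$. The family $\mathcal{G}_k^{(r)}$ consists of all $r$-graphs $H$ such that either $|H|=k$ and $|V(H)|\le (r-2)k+2$, or $|H|=\ell$ and $|V(H)|\le (r-2)\ell+1$ for some $\ell\in\{2,\dots,k-1\}$; $G$ is $\mathcal{G}_k^{(r)}$-free if it contains no member of this family as a subgraph (subset of edges). For $F\subseteq G$ and distinct vertices $x,y$, let $C_F(xy)$ be the set of integers $i\ge 0$ for which there exist $i$ distinct edges $e_1,\dots,e_i\in F$ with $|\{x,y\}\cup e_1\cup\dots\cup e_i|\le (r-2)i+2$; we say $F$ $i$-claims $xy$ if $i\in C_F(xy)$, and $F$ $\overline{1}2$-claims $xy$ if $2\in C_F(xy)$ and $1\notin C_F(xy)$. A diamond is an $r$-graph with exactly two edges, which intersect in exactly two vertices. An $r$-graph $F$ is connected if for any edges $X,Y\in F$ there are edges $X=X_1,\dots,X_m=Y$ of $F$ with $|X_i\cap X_{i+1}|\ge 2$ for all $i$. $\mathcal{M}_1$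 is the partition of $E(G)$ into maximal connected subgraphs (the 1-clusters). Edge-disjoint $F,H\subseteq G$ are $(1|2)$-mergeable (resp. $(2|1)$-mergeable) via a pair $xy$ if $1\in C_F(xy)$ and $2\in C_H(xy)$ (resp. $2\in C_F(xy)$ and $1\in C_H(xy)$); they are $1|2$-mergeable if they are $(1|2)$- or $(2|1)$-mergeable via some pair. $\mathcal{M}_2$ is a partition of $E(G)$ obtained from $\mathcal{M}_1$ by repeatedly replacing two distinct $1|2$-mergeable parts by their union as long as possible; $\mathcal{M}'_2$ is the set of all parts appearing at some stage of this process (partial 2-clusters). We say 1-clusters $T_1,\dots,T_\ell\in\mathcal{M}_1$ merge in this order if for each $i\in\{2,\dots,\ell\}$, $T_1\cup\dots\cup T_{i-1}$ and $T_i$ are $1|2$-mergeable. For an $r$-graph $H$, a diamond $D\subseteq H$ is flexible in $H$ if each edge $e\in D$ has exactly one vertex in $V(H\setminus D)$. $F\in\mathcal{M}'_2$ satisfies Property $\mathbb{P}$ if for every 1-cluster $T\in\mathcal{M}_1$ contained in $F$ there exist $\ell\ge 1$ and 1-clusters $T_1,\dots,T_\ell\in\mathcal{M}_1$ merging in this order such that $H=\bigcup_{p=1}^\ell T_p\subseteq F$, $|H|=k+1$, $T\in\{T_1,\dots,T_\ell\}$, and $T_1$ and $T_\ell$ are flexible diamonds in $H$ such that $T_1$ $\overline{1}2$-claims some pair that is $1$-claimed by $T_2$, and $T_\ell$ $\overline{1}2$-claims some pair that is $1$-claimed by $T_{\ell-1}$. *)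

theory Defs
  imports Main
begin

text \<open>
  An \<open>r\<close>-graph is identified with its edge set, of type \<open>'a set set\<close>; its vertex set is
  the union of its edges.  All \<open>r\<close>-graphs are finite.
\<close>

definition r_graph :: "nat \<Rightarrow> 'a set set \<Rightarrow> bool" where
  "r_graph r G \<longleftrightarrow> finite G \<and> (\<forall>e\<in>G. finite e \<and> card e = r)"

abbreviation verts :: "'a set set \<Rightarrow> 'a set" where
  "verts G \<equiv> \<Union>G"

definition bes_family :: "nat \<Rightarrow> nat \<Rightarrow> 'a set set set" where
  "bes_family r k = {H. r_graph r H \<and>
     (card H = k \<and> card (verts H) \<le> (r - 2) * k + 2 \<or>
      (\<exists>l\<in>{2..k - 1}. card H = l \<and> card (verts H) \<le> (r - 2) * l + 1))}"

definition bes_free :: "nat \<Rightarrow> nat \<Rightarrow> 'a set set \<Rightarrow> bool" where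
  "bes_free r k G \<longleftrightarrow> \<not> (\<exists>H\<in>bes_family r k. H \<subseteq> G)"

text \<open>
  \<open>claim_set r F x y\<close> is $C_F(xy)$; the \<open>i\<close> distinct edges are given as a set of
  \<open>i\<close> edges.  It is meant for \<open>x \<noteq> y\<close> only, and every use below requires this.
\<close>

definition claim_set :: "nat \<Rightarrow> 'a set set \<Rightarrow> 'a \<Rightarrow> 'a \<Rightarrow> nat set" where
  "claim_set r F x y = {i. \<exists>E\<subseteq>F. finite E \<and> card E = i \<and>
     card ({x, y} \<union> \<Union>E) \<le> (r - 2) * i + 2}"

definition claims :: "nat \<Rightarrow> nat \<Rightarrow> 'a set set \<Rightarrow> 'a \<Rightarrow> 'a \<Rightarrow> bool" where
  "claims r i F x y \<longleftrightarrow> i \<in> claim_set r F x y"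

definition not1_2_claims :: "nat \<Rightarrow> 'a set set \<Rightarrow> 'a \<Rightarrow> 'a \<Rightarrow> bool" where
  "not1_2_claims r F x y \<longleftrightarrow> 2 \<in> claim_set r F x y \<and> 1 \<notin> claim_set r F x y"

definition diamond :: "nat \<Rightarrow> 'a set set \<Rightarrow> bool" where
  "diamond r D \<longleftrightarrow> r_graph r D \<and> (\<exists>e f. e \<noteq> f \<and> D = {e, f} \<and> card (e \<inter> f) = 2)"

definition connected_graph :: "'a set set \<Rightarrow> bool" where
  "connected_graph F \<longleftrightarrow> (\<forall>X\<in>F. \<forall>Y\<in>F. \<exists>Xs. Xs \<noteq> [] \<and> hd Xs = X \<and> last Xs = Y \<and>
     set Xs \<subseteq> F \<and> successively (\<lambda>e f. card (e \<inter> f) \<ge> 2) Xs)"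

text \<open>The partition $\mathcal{M}_1$; its parts are nonempty.\<close>

definition one_clusters :: "'a set set \<Rightarrow> 'a set set set" where
  "one_clusters G = {T. T \<subseteq> G \<and> T \<noteq> {} \<and> connected_graph T \<and>
     (\<forall>T'. T \<subseteq> T' \<and> T' \<subseteq> G \<and> connected_graph T' \<longrightarrow> T' = T)}"

definition mergeable_via :: "nat \<Rightarrow> nat \<Rightarrow> nat \<Rightarrow> 'a set set \<Rightarrow> 'a set set \<Rightarrow> 'a \<Rightarrow> 'a \<Rightarrow> bool" where
  "mergeable_via r i j F H x y \<longleftrightarrow>
     F \<inter> H = {} \<and> x \<noteq> y \<and> i \<in> claim_set r F x y \<and> j \<in> claim_set r H x y"

definition mergeable_12 :: "nat \<Rightarrow> 'a set set \<Rightarrow> 'a set set \<Rightarrow> bool" where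
  "mergeable_12 r F H \<longleftrightarrow>
     (\<exists>x y. mergeable_via r 1 2 F H x y \<or> mergeable_via r 2 1 F H x y)"

definition merge_step :: "nat \<Rightarrow> 'a set set set \<Rightarrow> 'a set set set \<Rightarrow> bool" where
  "merge_step r P Q \<longleftrightarrow> (\<exists>F\<in>P. \<exists>H\<in>P. F \<noteq> H \<and> mergeable_12 r F H \<and>
     Q = insert (F \<union> H) (P - {F, H}))"

text \<open>
  A merging process is the list of successive partitions, from $\mathcal{M}_1$ to a
  partition in which no two distinct parts can be merged.  Its outcome depends on the
  choices made, so \<open>two_clustering r G M2 M2'\<close> relates $\mathcal{M}_2$ (final partition)
  and $\mathcal{M}'_2$ (all parts at all stages) of one and the same process.
\<close>

definition merging_process :: "nat \<Rightarrow> 'a set set \<Rightarrow> 'a set set set list \<Rightarrow> bool" where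
  "merging_process r G Ps \<longleftrightarrow> Ps \<noteq> [] \<and> hd Ps = one_clusters G \<and>
     successively (merge_step r) Ps \<and> \<not> (\<exists>Q. merge_step r (last Ps) Q)"

definition two_clustering ::
    "nat \<Rightarrow> 'a set set \<Rightarrow> 'a set set set \<Rightarrow> 'a set set set \<Rightarrow> bool" where
  "two_clustering r G M2 M2' \<longleftrightarrow>
     (\<exists>Ps. merging_process r G Ps \<and> M2 = last Ps \<and> M2' = \<Union>(set Ps))"

text \<open>The sequence $T_1,\dots,T_\ell$ is a function on \<open>nat\<close> used on \<open>{1..l}\<close> only.\<close>

definition merge_in_order :: "nat \<Rightarrow> nat \<Rightarrow> (nat \<Rightarrow> 'a set set) \<Rightarrow> bool" where
  "merge_in_order r l T \<longleftrightarrow> (\<forall>i\<in>{2..l}. mergeable_12 r (\<Union>p\<in>{1..i - 1}. T p) (T i))"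

definition flexible_diamond :: "nat \<Rightarrow> 'a set set \<Rightarrow> 'a set set \<Rightarrow> bool" where
  "flexible_diamond r H D \<longleftrightarrow> diamond r D \<and> D \<subseteq> H \<and>
     (\<forall>e\<in>D. card (e \<inter> verts (H - D)) = 1)"

text \<open>
  In \<open>property_P\<close>, the case \<open>l = 1\<close>, where \<open>T 2\<close> and \<open>T (l - 1)\<close> would be meaningless,
  cannot occur for \<open>k \<ge> 2\<close>: then \<open>H = T 1\<close> would be a diamond with \<open>k + 1 > 2\<close> edges.
\<close>

definition property_P :: "nat \<Rightarrow> nat \<Rightarrow> 'a set set \<Rightarrow> 'a set set \<Rightarrow> bool" where
  "property_P r k G F \<longleftrightarrow>
     (\<forall>T0\<in>one_clusters G. T0 \<subseteq> F \<longrightarrow>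
       (\<exists>l T H. l \<ge> 1 \<and> (\<forall>p\<in>{1..l}. T p \<in> one_clusters G) \<and> merge_in_order r l T \<and>
          H = (\<Union>p\<in>{1..l}. T p) \<and> H \<subseteq> F \<and> card H = k + 1 \<and> T0 \<in> T ` {1..l} \<and>
          flexible_diamond r H (T 1) \<and> flexible_diamond r H (T l) \<and>
          (\<exists>x y. x \<noteq> y \<and> not1_2_claims r (T 1) x y \<and> claims r 1 (T 2) x y) \<and>
          (\<exists>x y. x \<noteq> y \<and> not1_2_claims r (T l) x y \<and> claims r 1 (T (l - 1)) x y)))"

end

theory Submission
  imports Defs
begin

text \<open>
  Call a set of \<open>n > 0\<close> edges tight if it spans at most \<open>(r - 2) n + 2\<close> vertices; a tight subset
  of \<open>G\<close> never has exactly \<open>k\<close> edges.  Unions of successively mergeable 1-clusters are tight, and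
  from any tight subset one can grow to the whole union through tight sets in steps of one or two
  edges.  A new 1-cluster \<open>S\<close> merging with a 1-cluster \<open>T\<close> of a witness \<open>H\<close> for Property P can be
  glued to such tight sets inside \<open>H\<close> minus one of its two flexible diamonds (\<open>k - 1\<close> edges), which
  would produce a tight set of size \<open>k\<close> unless \<open>S\<close> is a diamond.  The same argument shows that in
  every union of \<open>k + 1\<close> edges a 1-cluster whose removal keeps the rest connected is a flexible
  diamond.  It then remains to reorder the 1-clusters after exchanging one end of \<open>H\<close> for \<open>S\<close>.
\<close>

section \<open>Orderings of connected graphs\<close>

text \<open>Connectedness is stated by cuts instead of paths, because every extension argument asks
  for an edge leaving a given part.\<close>

definition joined :: "('b \<Rightarrow> 'b \<Rightarrow> bool) \<Rightarrow> 'b set \<Rightarrow> bool" where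
  "joined R C \<longleftrightarrow> C \<noteq> {} \<and>
     (\<forall>A\<subseteq>C. A \<noteq> {} \<longrightarrow> A \<noteq> C \<longrightarrow> (\<exists>X\<in>A. \<exists>Y\<in>C - A. R X Y))"

definition growing :: "('b \<Rightarrow> 'b \<Rightarrow> bool) \<Rightarrow> 'b list \<Rightarrow> bool" where
  "growing R xs \<longleftrightarrow> distinct xs \<and>
     (\<forall>i<length xs. 0 < i \<longrightarrow> (\<exists>j<i. R (xs ! j) (xs ! i)))"

definition leaf :: "('b \<Rightarrow> 'b \<Rightarrow> bool) \<Rightarrow> 'b set \<Rightarrow> 'b \<Rightarrow> bool" where
  "leaf R C L \<longleftrightarrow> (\<forall>Y\<in>C. \<forall>Z\<in>C. R L Y \<longrightarrow> R L Z \<longrightarrow> Y = Z)"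

lemma joinedD:
  assumes "joined R C" "A \<subseteq> C" "A \<noteq> {}" "A \<noteq> C"
  obtains X Y where "X \<in> A" "Y \<in> C - A" "R X Y"
  using assms unfolding joined_def by blast

lemma joined_singleton: "joined R {X}"
  unfolding joined_def by auto

section \<open>Adding and deleting vertices of a connected set\<close>

lemma joined_insert:
  assumes sym: "symp R" and C: "joined R C" and X: "X \<in> C" "R X Y"
  shows "joined R (insert Y C)"
  unfolding joined_def
proof (intro conjI allI impI)
  fix A assume A: "A \<subseteq> insert Y C" "A \<noteq> {}" "A \<noteq> insert Y C"
  show "\<exists>U\<in>A. \<exists>V\<in>insert Y C - A. R U V"
  proof (cases "A \<inter> C = {} \<or> A \<inter> C = C")
    case False
    then obtain U V where "U \<in> A \<inter> C" "V \<in> C - (A \<inter> C)" "R U V"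
      using joinedD[OF C, of "A \<inter> C"] by blast
    then show ?thesis by blast
  next
    \<comment> \<open>Here \<open>A\<close> contains all or nothing of \<open>C\<close>, so the edge
      between \<open>X\<close> and \<open>Y\<close> crosses the cut, in one direction or the
      other.\<close>
    case True
    have "R Y X" using sym X(2) by (rule sympD)
    show ?thesis
    proof (cases "Y \<in> A")
      case True
      then have "X \<notin> A" using \<open>A \<inter> C = {} \<or> A \<inter> C = C\<close> A X by blast
      then show ?thesis using True X \<open>R Y X\<close> by blast
    next
      case False
      then have "X \<in> A" using \<open>A \<inter> C = {} \<or> A \<inter> C = C\<close> A X by blast
      then show ?thesis using False X by blast
    qed
  qed
qed auto

text \<open>A leaf is not a cut vertex. If the neighbour of \<open>L\<close> lies in
  \<open>A\<close>, the cut is enlarged by \<open>L\<close>, and the edge leaving it cannot start at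
  \<open>L\<close>; otherwise the edge leaving \<open>A\<close> in \<open>C\<close> cannot end at
  \<open>L\<close>.\<close>

lemma joined_remove_leaf:
  assumes sym: "symp R" and C: "joined R C" and L: "leaf R C L" and ne: "C \<noteq> {L}"
  shows "joined R (C - {L})"
  unfolding joined_def
proof (intro conjI allI impI)
  show "C - {L} \<noteq> {}" using C ne unfolding joined_def by blast
next
  fix A assume A: "A \<subseteq> C - {L}" "A \<noteq> {}" "A \<noteq> C - {L}"
  show "\<exists>X\<in>A. \<exists>Y\<in>C - {L} - A. R X Y"
  proof (cases "L \<in> C \<and> (\<exists>N\<in>A. R L N)")
    case True
    then obtain N where N: "N \<in> A" "R L N" by blast
    obtain X Y where XY: "X \<in> insert L A" "Y \<in> C - insert L A" "R X Y"
      using joinedD[OF C, of "insert L A"] A True by blast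
    have "X \<noteq> L"
      using XY N A(1) L unfolding leaf_def by blast
    then show ?thesis using XY by blast
  next
    case False
    obtain X Y where XY: "X \<in> A" "Y \<in> C - A" "R X Y"
      by (rule joinedD[OF C, of A]) (use A in auto)
    have "Y \<noteq> L" using XY False sym by (blast dest: sympD)
    then show ?thesis using XY by blast
  qed
qed

lemma joined_neighbour:
  assumes sym: "symp R" and "joined R C" "Y \<in> C" "C \<noteq> {Y}"
  obtains X where "X \<in> C - {Y}" "R X Y"
proof -
  obtain U V where "U \<in> {Y}" "V \<in> C - {Y}" "R U V"
    using joinedD[OF assms(2), of "{Y}"] assms by blast
  then show thesis using that sym by (blast dest: sympD)
qed

lemma leaf_mono: "leaf R C L \<Longrightarrow> B \<subseteq> C \<Longrightarrow> leaf R B L"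
  unfolding leaf_def by blast

section \<open>Enumerations along which a connected set grows\<close>

lemma growing_singleton: "growing R [x]"
  unfolding growing_def by auto

text \<open>Nonemptiness of \<open>xs\<close> matters: the first entry of an enumeration is free of
  any attachment condition.\<close>

lemma growing_snoc:
  assumes "xs \<noteq> []"
  shows "growing R (xs @ [y]) \<longleftrightarrow> growing R xs \<and> y \<notin> set xs \<and> (\<exists>x\<in>set xs. R x y)"
proof
  assume g: "growing R (xs @ [y])"
  have "\<exists>j<i. R (xs ! j) (xs ! i)" if i: "i < length xs" "0 < i" for i
  proof -
    obtain j where "j < i" "R ((xs @ [y]) ! j) ((xs @ [y]) ! i)"
      using g i(2) less_SucI[OF i(1)] unfolding growing_def by auto
    then show ?thesis using i by (auto simp: nth_append)
  qed
  moreover obtain j where "j < length xs" "R ((xs @ [y]) ! j) ((xs @ [y]) ! length xs)"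
    using g assms unfolding growing_def by auto
  ultimately show "growing R xs \<and> y \<notin> set xs \<and> (\<exists>x\<in>set xs. R x y)"
    using g unfolding growing_def by (auto simp: nth_append)
next
  assume g: "growing R xs \<and> y \<notin> set xs \<and> (\<exists>x\<in>set xs. R x y)"
  then obtain j where j: "j < length xs" "R (xs ! j) y" by (auto simp: in_set_conv_nth)
  have "\<exists>j<i. R ((xs @ [y]) ! j) ((xs @ [y]) ! i)" if i: "i < length (xs @ [y])" "0 < i" for i
  proof (cases "i < length xs")
    case True
    then obtain j where "j < i" "R (xs ! j) (xs ! i)" using g i unfolding growing_def by blast
    then show ?thesis using True by (auto simp: nth_append intro!: exI[of _ j])
  next
    case False
    then have "i = length xs" using i by simp
    then show ?thesis using j by (auto simp: nth_append intro!: exI[of _ j])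
  qed
  then show "growing R (xs @ [y])" using g unfolding growing_def by auto
qed

lemma growing_joined:
  assumes "symp R" "growing R xs" "xs \<noteq> []"
  shows "joined R (set xs)"
  using assms(2,3)
proof (induction xs rule: rev_induct)
  case (snoc y xs)
  show ?case
  proof (cases "xs = []")
    case True
    then show ?thesis by (simp add: joined_singleton)
  next
    case False
    then obtain x where "growing R xs" "x \<in> set xs" "R x y"
      using snoc.prems growing_snoc[OF False] by blast
    then show ?thesis using joined_insert[OF assms(1)] snoc.IH False by simp
  qed
qed simp

text \<open>Greedy extension: the cut formed by the entries listed so far supplies the next
  one.\<close>

lemma joined_growing_extend:
  assumes "joined R C" "finite C" "growing R ps" "ps \<noteq> []" "set ps \<subseteq> C"
  shows "\<exists>xs. growing R (ps @ xs) \<and> set (ps @ xs) = C"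
  using assms(3-5)
proof (induction "card (C - set ps)" arbitrary: ps rule: less_induct)
  case less
  show ?case
  proof (cases "set ps = C")
    case True
    then show ?thesis using less.prems by (intro exI[of _ "[]"]) simp
  next
    case False
    then obtain X Y where XY: "X \<in> set ps" "Y \<in> C - set ps" "R X Y"
      using joinedD[OF assms(1), of "set ps"] less.prems by auto
    have "C - set (ps @ [Y]) \<subset> C - set ps" using XY by auto
    then have "card (C - set (ps @ [Y])) < card (C - set ps)"
      using assms(2) by (meson finite_Diff psubset_card_mono)
    moreover have "growing R (ps @ [Y])"
      using XY less.prems growing_snoc[OF less.prems(2)] by blast
    ultimately obtain xs where "growing R ((ps @ [Y]) @ xs) \<and> set ((ps @ [Y]) @ xs) = C"
      using less.hyps[of "ps @ [Y]"] less.prems XY by auto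
    then show ?thesis by (intro exI[of _ "Y # xs"]) simp
  qed
qed

lemma joined_growing:
  assumes "joined R C" "finite C" "X \<in> C"
  obtains xs where "growing R (X # xs)" "set (X # xs) = C"
  using joined_growing_extend[OF assms(1,2), of "[X]"] assms(3) growing_singleton by force

text \<open>Think of \<open>C\<close> as the clusters of a witness, \<open>P\<close> and
  \<open>Q\<close> as its ends, \<open>M\<close> as the neighbour of \<open>Q\<close>, and
  \<open>S\<close> as a new cluster attached at \<open>T\<close>. An end \<open>D\<close> other than
  \<open>T\<close> is given up for \<open>S\<close>. The first entry of the new enumeration must not
  be a cut vertex and the last two must be adjacent, since the first and last entries become the
  ends of a new witness. If \<open>T\<close> is none of \<open>P\<close>, \<open>Q\<close>,
  \<open>M\<close>, the order \<open>S, T, ..., M, Q\<close> works without \<open>P\<close>;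
  otherwise an order ending in \<open>T, S\<close> works.\<close>

lemma exchange_leaf:
  assumes sym: "symp R" and fin: "finite C" and C: "joined R C"
    and PQM: "P \<in> C" "Q \<in> C" "M \<in> C" "P \<noteq> Q" "M \<noteq> P" "M \<noteq> Q"
    and MQ: "R M Q" and lP: "leaf R C P" and lQ: "leaf R C Q" and CQM: "joined R (C - {Q, M})"
    and TS: "T \<in> C" "S \<notin> C" "R T S"
  obtains D ws Y Z where "D \<in> {P, Q}" "D \<noteq> T" "ws \<noteq> []" "growing R (ws @ [Y, Z])"
    "set (ws @ [Y, Z]) = insert S (C - {D})" "joined R (insert S (C - {D}) - {hd ws})" "R Y Z"
proof -
  note jl = joined_remove_leaf[OF sym]
  have CP: "joined R (C - {P})" using jl[OF C lP] PQM by blast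
  have CQ: "joined R (C - {Q})" using jl[OF C lQ] PQM by blast
  have CPQ: "joined R (C - {P} - {Q})"
    by (rule jl[OF CP leaf_mono[OF lQ]]) (use PQM in blast)+
  have CQP: "joined R (C - {Q} - {P})" using CPQ by (simp add: Diff_insert2[symmetric] insert_commute)
  show thesis
  proof (cases "T \<in> {P, Q, M}")
    case False
    have "joined R (C - {Q, M} - {P})"
      by (rule jl[OF CQM leaf_mono[OF lP]]) (use PQM TS False in blast)+
    then have "joined R (insert S (C - {Q, M} - {P}))"
      using joined_insert[OF sym] TS False by blast
    moreover have "growing R ([S] @ [T])"
      using TS sym by (subst growing_snoc) (auto simp: growing_singleton dest: sympD)
    ultimately obtain xs where xs: "growing R ([S, T] @ xs)"
      "set ([S, T] @ xs) = insert S (C - {Q, M} - {P})"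
      using joined_growing_extend[of R "insert S (C - {Q, M} - {P})" "[S, T]"] fin TS False by auto
    \<comment> \<open>Removing both leaves \<open>P\<close> and \<open>Q\<close> keeps
      \<open>C\<close> connected, so \<open>M\<close> has a neighbour among the entries already
      listed.\<close>
    obtain X where X: "X \<in> C - {P} - {Q} - {M}" "R X M"
      by (rule joined_neighbour[OF sym CPQ, of M]) (use PQM TS False in auto)
    have X': "X \<in> set ([S, T] @ xs)" using X unfolding xs(2) by blast
    have notin: "M \<notin> set ([S, T] @ xs)" "Q \<notin> set ([S, T] @ xs)"
      unfolding xs(2) using PQM TS by auto
    have g1: "growing R (([S, T] @ xs) @ [M])"
      by (subst growing_snoc) (use xs(1) notin X' X in blast)+
    have g2: "growing R ((([S, T] @ xs) @ [M]) @ [Q])"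
      by (subst growing_snoc) (use g1 notin PQM MQ in auto)
    show thesis
    proof (rule that[of P "[S, T] @ xs" M Q])
      show "set (([S, T] @ xs) @ [M, Q]) = insert S (C - {P})"
      proof -
        have "set (([S, T] @ xs) @ [M, Q]) = insert S (C - {Q, M} - {P}) \<union> {M, Q}"
          using xs(2) by (metis set_append list.set(1,2))
        also have "\<dots> = insert S (C - {P})" using PQM by blast
        finally show ?thesis by simp
      qed
      have "insert S (C - {P}) - {hd ([S, T] @ xs)} = C - {P}" using TS by auto
      then show "joined R (insert S (C - {P}) - {hd ([S, T] @ xs)})" using CP by simp
    qed (use g2 False MQ in auto)
  next
    case True
    \<comment> \<open>\<open>D\<close> is \<open>Q\<close> unless \<open>T = Q\<close>, when it is
      \<open>P\<close>. In each case \<open>T\<close> is not a cut vertex of \<open>C - {D}\<close>: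
      it is a leaf, or it is \<open>M\<close>, covered by the hypothesis on
      \<open>C - {Q, M}\<close>.\<close>
    obtain D where D: "D \<in> {P, Q}" "D \<noteq> T" "joined R (C - {D})" "joined R (C - {D} - {T})"
    proof (cases "T = Q")
      case True
      then show thesis using that[of P] CP CPQ PQM by blast
    next
      case False
      then have "joined R (C - {Q} - {T})"
        using True CQM CQP by (auto simp: Diff_insert2[symmetric] insert_commute)
      then show thesis using that[of Q] CQ False by blast
    qed
    have TD: "T \<in> C - {D}" using D TS by blast
    have nsing: "C - {D} \<noteq> {T}"
    proof
      assume eq: "C - {D} = {T}"
      have "M \<in> C - {D}" using D(1) PQM(3,5,6) by auto
      then have "M = T" unfolding eq by simp
      have "P \<in> C - {D} \<or> Q \<in> C - {D}" using D(1) PQM(1,2,4) by auto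
      then have "P = T \<or> Q = T" unfolding eq by simp
      then show False using \<open>M = T\<close> PQM(5,6) by simp
    qed
    \<comment> \<open>The last entry \<open>L\<close> of an enumeration starting at \<open>T\<close>
      is not a cut vertex of \<open>C - {D}\<close> and differs from \<open>T\<close>; it will head
      the final enumeration.\<close>
    obtain ys where ys: "growing R (T # ys)" "set (T # ys) = C - {D}"
      by (rule joined_growing[OF D(3) finite_Diff[OF fin] TD])
    have "ys \<noteq> []"
    proof
      assume "ys = []"
      then show False using ys(2) nsing unfolding \<open>ys = []\<close> by simp
    qed
    then obtain zs L where zL: "ys = zs @ [L]" by (metis rev_exhaust)
    have "growing R ((T # zs) @ [L])" using ys(1) unfolding zL by simp
    then have g: "growing R (T # zs)" and Lnot: "L \<notin> set (T # zs)"
      using growing_snoc[of "T # zs" R L] by blast+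
    have "set (T # zs) = set (T # ys) - {L}" using Lnot unfolding zL by auto
    then have setzs: "set (T # zs) = C - {D} - {L}" unfolding ys(2) .
    have "joined R (set (T # zs))" by (rule growing_joined[OF sym g]) simp
    then have CDL: "joined R (C - {D} - {L})" unfolding setzs .
    have "L \<in> set (T # ys)" unfolding zL by simp
    then have "L \<in> C - {D}" unfolding ys(2) .
    then have LC: "L \<in> C - {D} - {T}" using Lnot by simp
    \<comment> \<open>Second enumeration: it starts at \<open>L\<close> and omits \<open>T\<close>,
      so that \<open>T\<close> and then \<open>S\<close> can be appended at the end.\<close>
    obtain xs where xs: "growing R (L # xs)" "set (L # xs) = C - {D} - {T}"
      by (rule joined_growing[OF D(4) finite_Diff[OF finite_Diff[OF fin]] LC])
    obtain X where X: "X \<in> C - {D} - {T}" "R X T"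
      by (rule joined_neighbour[OF sym D(3) TD nsing])
    have g1: "growing R ((L # xs) @ [T])"
      by (subst growing_snoc) (use xs X in blast)+
    have Snot: "S \<notin> set (L # xs)" "S \<noteq> T" unfolding xs(2) using TS by auto
    have g2: "growing R (((L # xs) @ [T]) @ [S])"
      by (subst growing_snoc) (use g1 Snot TS in auto)
    show thesis
    proof (rule that[of D "L # xs" T S])
      have "set ((L # xs) @ [T, S]) = set (L # xs) \<union> {T, S}" by auto
      also have "\<dots> = insert S (C - {D})" unfolding xs(2) using TD by auto
      finally show "set ((L # xs) @ [T, S]) = insert S (C - {D})" .
      have "joined R (insert S (C - {D} - {L}))"
        using joined_insert[OF sym CDL, of T S] TS TD LC by blast
      moreover have "insert S (C - {D}) - {hd (L # xs)} = insert S (C - {D} - {L})"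
        using LC TS by auto
      ultimately show "joined R (insert S (C - {D}) - {hd (L # xs)})" by simp
    qed (use g2 D TS in auto)
  qed
qed

section \<open>Connected graphs\<close>

definition adjacency :: "'a set set \<Rightarrow> ('a set \<times> 'a set) set" where
  "adjacency F = {(e, f). e \<in> F \<and> f \<in> F \<and> card (e \<inter> f) \<ge> 2}"

text \<open>Lists of edges are traded for reachability, which brings transitivity, monotonicity and
  induction of the closure.\<close>

lemma connected_graph_iff:
  "connected_graph F \<longleftrightarrow> (\<forall>X\<in>F. \<forall>Y\<in>F. (X, Y) \<in> (adjacency F)\<^sup>*)"
proof -
  have fwd: "(hd Xs, last Xs) \<in> (adjacency F)\<^sup>*"
    if "Xs \<noteq> []" "set Xs \<subseteq> F" "successively (\<lambda>e f. card (e \<inter> f) \<ge> 2) Xs" for Xs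
    using that
  proof (induction Xs)
    case (Cons X Xs)
    show ?case
    proof (cases "Xs = []")
      case False
      then have "(X, hd Xs) \<in> adjacency F" "(hd Xs, last Xs) \<in> (adjacency F)\<^sup>*"
        using Cons by (auto simp: successively_Cons adjacency_def)
      then show ?thesis using False by (simp add: converse_rtrancl_into_rtrancl)
    qed simp
  qed simp
  have bwd: "\<exists>Xs. Xs \<noteq> [] \<and> hd Xs = X \<and> last Xs = Y \<and> set Xs \<subseteq> F \<and>
      successively (\<lambda>e f. card (e \<inter> f) \<ge> 2) Xs"
    if "(X, Y) \<in> (adjacency F)\<^sup>*" "Y \<in> F" for X Y
    using that
  proof (induction rule: converse_rtrancl_induct)
    case base
    then show ?case by (intro exI[of _ "[Y]"]) simp
  next
    case (step U V)
    then obtain Xs where "Xs \<noteq> []" "hd Xs = V" "last Xs = Y" "set Xs \<subseteq> F"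
      "successively (\<lambda>e f. card (e \<inter> f) \<ge> 2) Xs" by blast
    then show ?case using step(1)
      by (intro exI[of _ "U # Xs"]) (auto simp: successively_Cons adjacency_def)
  qed
  show ?thesis
  proof
    assume c: "connected_graph F"
    show "\<forall>X\<in>F. \<forall>Y\<in>F. (X, Y) \<in> (adjacency F)\<^sup>*"
    proof (intro ballI)
      fix X Y assume "X \<in> F" "Y \<in> F"
      then obtain Xs where "Xs \<noteq> []" "hd Xs = X" "last Xs = Y" "set Xs \<subseteq> F"
        "successively (\<lambda>e f. card (e \<inter> f) \<ge> 2) Xs"
        using c unfolding connected_graph_def by blast
      then show "(X, Y) \<in> (adjacency F)\<^sup>*" using fwd by blast
    qed
  next
    assume "\<forall>X\<in>F. \<forall>Y\<in>F. (X, Y) \<in> (adjacency F)\<^sup>*"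
    then show "connected_graph F" unfolding connected_graph_def using bwd by blast
  qed
qed

lemma adjacency_mono: "F \<subseteq> F' \<Longrightarrow> adjacency F \<subseteq> adjacency F'"
  unfolding adjacency_def by blast

lemma connected_graph_Un:
  assumes "connected_graph F" "connected_graph F'" "F \<inter> F' \<noteq> {}"
  shows "connected_graph (F \<union> F')"
proof -
  obtain Z where Z: "Z \<in> F" "Z \<in> F'" using assms(3) by blast
  have "(adjacency F)\<^sup>* \<subseteq> (adjacency (F \<union> F'))\<^sup>*" "(adjacency F')\<^sup>* \<subseteq> (adjacency (F \<union> F'))\<^sup>*"
    by (simp_all add: adjacency_mono rtrancl_mono)
  then have "(X, Z) \<in> (adjacency (F \<union> F'))\<^sup>* \<and> (Z, X) \<in> (adjacency (F \<union> F'))\<^sup>*"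
    if "X \<in> F \<union> F'" for X
    using that Z assms(1,2) unfolding connected_graph_iff by blast
  then show ?thesis unfolding connected_graph_iff by (meson rtrancl_trans)
qed

lemma connected_graph_singleton: "connected_graph {e}"
  unfolding connected_graph_iff by simp

lemma connected_graph_pair:
  assumes "card (e \<inter> f) \<ge> 2"
  shows "connected_graph {e, f}"
proof -
  have "(e, f) \<in> adjacency {e, f}" "(f, e) \<in> adjacency {e, f}"
    using assms unfolding adjacency_def by (auto simp: Int_commute)
  then show ?thesis unfolding connected_graph_iff by auto
qed

text \<open>A walk from \<open>X\<close> to \<open>Y\<close> has to leave \<open>A\<close> at some
  step.\<close>

lemma connected_graph_cut:
  assumes "connected_graph F" "X \<in> F" "X \<in> A" "Y \<in> F" "Y \<notin> A"
  obtains e f where "e \<in> F" "e \<in> A" "f \<in> F" "f \<notin> A" "card (e \<inter> f) \<ge> 2"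
proof -
  have "(X, Y) \<in> (adjacency F)\<^sup>*" using assms unfolding connected_graph_iff by blast
  then have "\<exists>e f. e \<in> A \<and> f \<notin> A \<and> (e, f) \<in> adjacency F"
    using assms(5) assms(3)
    by (induction rule: rtrancl_induct) blast+
  then show thesis using that unfolding adjacency_def by blast
qed

lemma card_ge_2_obtain:
  assumes "card A \<ge> 2"
  obtains x y where "x \<in> A" "y \<in> A" "x \<noteq> y"
proof -
  have "\<not> A \<subseteq> {z}" for z
    using assms card_mono[of "{z}" A] by auto
  then show thesis using that by blast
qed

lemma card_ge_2I: "finite A \<Longrightarrow> x \<in> A \<Longrightarrow> y \<in> A \<Longrightarrow> x \<noteq> y \<Longrightarrow> card A \<ge> 2"
  using card_mono[of A "{x, y}"] by simp


section \<open>Tight edge sets and clusters\<close>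

lemma symp_mergeable_12: "symp (mergeable_12 r)"
  unfolding symp_def mergeable_12_def mergeable_via_def by blast

text \<open>Claim sets grow with the edge set; only disjointness has to be assumed afresh.\<close>

lemma mergeable_12_mono:
  fixes X Y X' Y' :: "'a set set"
  assumes "mergeable_12 r X Y" "X \<subseteq> X'" "Y \<subseteq> Y'" "X' \<inter> Y' = {}"
  shows "mergeable_12 r X' Y'"
proof -
  have mono: "i \<in> claim_set r B x y" if "i \<in> claim_set r A x y" "A \<subseteq> B" for A B :: "'a set set" and i x y
    using that unfolding claim_set_def by blast
  have "mergeable_via r i j X Y x y \<Longrightarrow> mergeable_via r i j X' Y' x y" for i j x y
    using mono[OF _ assms(2)] mono[OF _ assms(3)] assms(4) unfolding mergeable_via_def by simp
  then show ?thesis using assms(1) unfolding mergeable_12_def by meson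
qed

locale bes_free_graph =
  fixes r k :: nat and G :: "'a set set"
  assumes r_ge_3: "r \<ge> 3" and k_ge_3: "k \<ge> 3" and r_graph_G: "r_graph r G"
    and bes_free_G: "bes_free r k G"
begin

section \<open>Vertex counts of tight edge sets\<close>

definition tight :: "'a set set \<Rightarrow> bool" where
  "tight E \<longleftrightarrow> E \<subseteq> G \<and> E \<noteq> {} \<and> card (\<Union>E) \<le> (r - 2) * card E + 2"

lemma finite_G: "finite G"
  using r_graph_G unfolding r_graph_def by blast

lemma finite_sub: "E \<subseteq> G \<Longrightarrow> finite E"
  using finite_G finite_subset by blast

lemma edge: "e \<in> G \<Longrightarrow> finite e" "e \<in> G \<Longrightarrow> card e = r"
  using r_graph_G unfolding r_graph_def by blast+

lemma finite_verts: "E \<subseteq> G \<Longrightarrow> finite (\<Union>E)"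
  using finite_sub edge(1) by blast

lemma r_graph_sub: "E \<subseteq> G \<Longrightarrow> r_graph r E"
  using r_graph_G finite_sub unfolding r_graph_def by blast

lemma tight_card_neq: "tight E \<Longrightarrow> card E \<noteq> k"
  using bes_free_G r_graph_sub unfolding tight_def bes_free_def bes_family_def by blast

text \<open>Sizes from 2 to \<open>k - 1\<close> are handled by the second alternative of the
  forbidden family, and a single edge has exactly \<open>r = (r - 2) + 2\<close> vertices. Tightness
  below \<open>k\<close> edges is therefore an equality.\<close>

lemma card_verts_ge:
  assumes E: "E \<subseteq> G" "E \<noteq> {}" "card E < k"
  shows "(r - 2) * card E + 2 \<le> card (\<Union>E)"
proof (cases "card E = 1")
  case True
  then obtain e where "E = {e}" by (rule card_1_singletonE)
  then show ?thesis using E edge(2) r_ge_3 by auto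
next
  case False
  have "card E \<noteq> 0" using E finite_sub by auto
  then have "card E \<in> {2..k - 1}" using False E by auto
  then have "\<not> card (\<Union>E) \<le> (r - 2) * card E + 1"
    using bes_free_G r_graph_sub[OF E(1)] E(1) unfolding bes_free_def bes_family_def by blast
  then show ?thesis by simp
qed

lemma tight_card_verts: "tight E \<Longrightarrow> card E < k \<Longrightarrow> card (\<Union>E) = (r - 2) * card E + 2"
  using card_verts_ge unfolding tight_def by (meson le_antisym)

lemma tight_edge: "e \<in> G \<Longrightarrow> tight {e}"
  using edge(2) r_ge_3 unfolding tight_def by simp

text \<open>When the two vertex bounds are added, the at least two shared vertices cancel one of the
  two summands \<open>+ 2\<close>.\<close>

lemma tight_Un:
  assumes A: "tight A" and E: "tight E" and disj: "A \<inter> E = {}"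
    and xy: "x \<noteq> y" "x \<in> \<Union>A" "y \<in> \<Union>A" "x \<in> \<Union>E" "y \<in> \<Union>E"
  shows "tight (A \<union> E)"
proof -
  have fin: "finite (\<Union>A)" "finite (\<Union>E)" "finite A" "finite E"
    using A E finite_verts finite_sub unfolding tight_def by blast+
  have "2 \<le> card (\<Union>A \<inter> \<Union>E)"
    by (rule card_ge_2I[of _ x y]) (use fin xy in auto)
  moreover have "card (\<Union>A) + card (\<Union>E) = card (\<Union>A \<union> \<Union>E) + card (\<Union>A \<inter> \<Union>E)"
    using card_Un_Int fin by blast
  moreover have "card (A \<union> E) = card A + card E"
    using card_Un_disjoint fin disj by blast
  ultimately show ?thesis
    using A E unfolding tight_def by (auto simp: Union_Un_distrib distrib_left)
qed

lemma tight_insert: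
  assumes "tight A" "e \<in> G" "e \<notin> A" "f \<in> A" "card (f \<inter> e) \<ge> 2"
  shows "tight (insert e A)"
proof -
  obtain x y where "x \<in> f \<inter> e" "y \<in> f \<inter> e" "x \<noteq> y"
    using card_ge_2_obtain[OF assms(5)] by blast
  then have "tight (A \<union> {e})"
    using tight_Un[OF assms(1) tight_edge[OF assms(2)], of x y] assms by blast
  then show ?thesis by simp
qed

text \<open>Two edges are fewer than \<open>k\<close>, so their union has exactly
  \<open>(r - 2) * 2 + 2\<close> vertices.\<close>

lemma tight_pair_card_Int:
  assumes "tight {e, f}" "e \<noteq> f"
  shows "card (e \<inter> f) = 2"
proof -
  have ef: "e \<in> G" "f \<in> G" using assms unfolding tight_def by auto
  have "card (e \<union> f) = (r - 2) * 2 + 2"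
    using tight_card_verts[OF assms(1)] assms(2) k_ge_3 by simp
  moreover have "card e + card f = card (e \<union> f) + card (e \<inter> f)"
    using card_Un_Int ef edge(1) by blast
  ultimately show ?thesis using edge(2) ef r_ge_3 by simp
qed

text \<open>This confines the edges that claim a merging pair to a single 1-cluster.\<close>

lemma tight_connected:
  assumes "tight E" "card E \<in> {1, 2}"
  shows "connected_graph E"
proof (cases "card E = 1")
  case True
  then obtain e where "E = {e}" by (rule card_1_singletonE)
  then show ?thesis by (simp add: connected_graph_singleton)
next
  case False
  then have "card E = 2" using assms(2) by simp
  then obtain e f where "E = {e, f}" "e \<noteq> f" unfolding card_2_iff by blast
  then show ?thesis using tight_pair_card_Int[of e f] assms(1) connected_graph_pair[of e f] by simp
qed

section \<open>Claims and mergeability in terms of tight sets\<close>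

lemma claim_set_iff:
  assumes F: "F \<subseteq> G" and i: "i \<in> {1, 2}"
  shows "i \<in> claim_set r F x y \<longleftrightarrow> (\<exists>E\<subseteq>F. card E = i \<and> tight E \<and> x \<in> \<Union>E \<and> y \<in> \<Union>E)"
proof
  assume "i \<in> claim_set r F x y"
  then obtain E where E: "E \<subseteq> F" "card E = i" "card ({x, y} \<union> \<Union>E) \<le> (r - 2) * i + 2"
    unfolding claim_set_def by blast
  have EG: "E \<subseteq> G" "E \<noteq> {}" using E F i by auto
  have fin: "finite ({x, y} \<union> \<Union>E)" using finite_verts[OF EG(1)] by simp
  \<comment> \<open>Since \<open>i < k\<close>, the edges alone already span at least the permitted
    number of vertices, so \<open>x\<close> and \<open>y\<close> must lie among them.\<close>
  have ge: "(r - 2) * i + 2 \<le> card (\<Union>E)"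
    using card_verts_ge[OF EG] E(2) i k_ge_3 by auto
  then have "card ({x, y} \<union> \<Union>E) \<le> card (\<Union>E)" using E(3) by linarith
  then have "\<Union>E = {x, y} \<union> \<Union>E" by (rule card_seteq[OF fin Un_upper2])
  then have "x \<in> \<Union>E" "y \<in> \<Union>E" by (metis UnCI insertCI)+
  moreover have "tight E"
    using EG E(2) le_trans[OF card_mono[OF fin Un_upper2] E(3)] unfolding tight_def by blast
  ultimately show "\<exists>E\<subseteq>F. card E = i \<and> tight E \<and> x \<in> \<Union>E \<and> y \<in> \<Union>E"
    using E(1,2) by blast
next
  assume "\<exists>E\<subseteq>F. card E = i \<and> tight E \<and> x \<in> \<Union>E \<and> y \<in> \<Union>E"
  then obtain E where E: "E \<subseteq> F" "card E = i" "tight E" "x \<in> \<Union>E" "y \<in> \<Union>E" by blast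
  then have "{x, y} \<union> \<Union>E = \<Union>E" by auto
  then show "i \<in> claim_set r F x y"
    using E F finite_sub unfolding claim_set_def tight_def by auto
qed

lemma claim_set_1_iff:
  assumes F: "F \<subseteq> G"
  shows "1 \<in> claim_set r F x y \<longleftrightarrow> (\<exists>e\<in>F. x \<in> e \<and> y \<in> e)"
proof -
  have "(\<exists>E\<subseteq>F. card E = 1 \<and> tight E \<and> x \<in> \<Union>E \<and> y \<in> \<Union>E) \<longleftrightarrow> (\<exists>e\<in>F. x \<in> e \<and> y \<in> e)"
  proof
    assume "\<exists>E\<subseteq>F. card E = 1 \<and> tight E \<and> x \<in> \<Union>E \<and> y \<in> \<Union>E"
    then obtain E where E: "E \<subseteq> F" "card E = 1" "x \<in> \<Union>E" "y \<in> \<Union>E" by blast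
    obtain e where "E = {e}" using E(2) by (rule card_1_singletonE)
    then show "\<exists>e\<in>F. x \<in> e \<and> y \<in> e" using E by auto
  next
    assume "\<exists>e\<in>F. x \<in> e \<and> y \<in> e"
    then obtain e where "e \<in> F" "x \<in> e" "y \<in> e" by blast
    then show "\<exists>E\<subseteq>F. card E = 1 \<and> tight E \<and> x \<in> \<Union>E \<and> y \<in> \<Union>E"
      using F tight_edge by (intro exI[of _ "{e}"]) auto
  qed
  then show ?thesis using claim_set_iff[OF F, of 1] by simp
qed

lemma mergeable_12_iff:
  assumes "X \<subseteq> G" "Y \<subseteq> G"
  shows "mergeable_12 r X Y \<longleftrightarrow> X \<inter> Y = {} \<and> (\<exists>E E' x y. x \<noteq> y \<and> E \<subseteq> X \<and> E' \<subseteq> Y \<and>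
    tight E \<and> tight E' \<and> {x, y} \<subseteq> \<Union>E \<and> {x, y} \<subseteq> \<Union>E' \<and>
    (card E = 1 \<and> card E' = 2 \<or> card E = 2 \<and> card E' = 1))"
  unfolding mergeable_12_def mergeable_via_def
  using claim_set_iff[OF assms(1), of 1] claim_set_iff[OF assms(1), of 2]
    claim_set_iff[OF assms(2), of 1] claim_set_iff[OF assms(2), of 2]
  by (simp, blast)

lemma mergeable_12E:
  assumes "mergeable_12 r X Y" "X \<subseteq> G" "Y \<subseteq> G"
  obtains E E' x y where "x \<noteq> y" "E \<subseteq> X" "E' \<subseteq> Y" "tight E" "tight E'"
    "{x, y} \<subseteq> \<Union>E" "{x, y} \<subseteq> \<Union>E'"
    "card E = 1 \<and> card E' = 2 \<or> card E = 2 \<and> card E' = 1" "X \<inter> Y = {}"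
proof -
  from assms(1) show thesis
    unfolding mergeable_12_iff[OF assms(2,3)]
    by (elim conjE exE) (rule that; assumption)
qed

section \<open>1-clusters as maximal connected sets\<close>

abbreviation clusters :: "'a set set set" where
  "clusters \<equiv> one_clusters G"

lemma clusterD:
  assumes "T \<in> clusters"
  shows "T \<subseteq> G" "T \<noteq> {}" "connected_graph T" "finite T"
  using assms finite_sub unfolding one_clusters_def by auto

lemma Union_clusters_sub: "C \<subseteq> clusters \<Longrightarrow> \<Union>C \<subseteq> G"
  using clusterD(1) by blast

lemma cluster_maximal: "T \<in> clusters \<Longrightarrow> T \<subseteq> T' \<Longrightarrow> T' \<subseteq> G \<Longrightarrow> connected_graph T' \<Longrightarrow> T' = T"
  unfolding one_clusters_def by blast

lemma cluster_absorbs: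
  assumes "T \<in> clusters" "E \<subseteq> G" "connected_graph E" "E \<inter> T \<noteq> {}"
  shows "E \<subseteq> T"
proof -
  have "connected_graph (T \<union> E)"
    by (rule connected_graph_Un) (use assms clusterD(3) in blast)+
  then have "T \<union> E = T"
    using assms clusterD(1) by (intro cluster_maximal) auto
  then show ?thesis by blast
qed

lemma cluster_disjoint:
  assumes "T \<in> clusters" "T' \<in> clusters" "T \<noteq> T'"
  shows "T \<inter> T' = {}"
  using cluster_absorbs[of T T'] cluster_absorbs[of T' T] assms clusterD by blast

lemma connected_in_cluster:
  assumes "E \<subseteq> G" "E \<noteq> {}" "connected_graph E"
  obtains T where "T \<in> clusters" "E \<subseteq> T"
proof -
  let ?A = "{T'. T' \<subseteq> G \<and> connected_graph T'}"
  have "finite ?A" using finite_G by simp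
  then obtain T where T: "T \<in> ?A" "E \<subseteq> T" "\<And>T'. T' \<in> ?A \<Longrightarrow> T \<subseteq> T' \<Longrightarrow> T = T'"
    using finite_has_maximal2[of ?A E] assms by auto
  then have "T \<in> clusters" using assms(2) unfolding one_clusters_def by blast
  then show thesis using that T by blast
qed

lemma cluster_cover:
  assumes "e \<in> G" obtains T where "T \<in> clusters" "e \<in> T"
  using connected_in_cluster[of "{e}"] connected_graph_singleton[of e] assms by auto

text \<open>Two edges through a common pair are adjacent, so a pair is 1-claimed by at most one
  1-cluster.\<close>

lemma cluster_unique_pair:
  assumes T: "T \<in> clusters" "T' \<in> clusters" "e \<in> T" "f \<in> T'"
    and xy: "x \<noteq> y" "{x, y} \<subseteq> e" "{x, y} \<subseteq> f"
  shows "T = T'"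
proof -
  have G: "e \<in> G" "f \<in> G" using T clusterD(1) by blast+
  have "card (e \<inter> f) \<ge> 2"
    by (rule card_ge_2I[of _ x y]) (use edge(1) G xy in auto)
  then have "connected_graph {e, f}" by (rule connected_graph_pair)
  then have "{e, f} \<subseteq> T" using cluster_absorbs[of T "{e, f}"] T G by blast
  then show ?thesis using cluster_disjoint[of T T'] T by blast
qed

lemma Union_clusters_diff:
  assumes "C \<subseteq> clusters" "D \<in> clusters"
  shows "\<Union>(C - {D}) = \<Union>C - D"
  using assms cluster_disjoint[of _ D] by blast

section \<open>Growing tight sets in small steps\<close>

lemma tight_fill_cluster:
  assumes T: "T \<in> clusters" and A: "tight A" "A \<inter> T \<noteq> {}" "card A \<le> n" "n \<le> card (A \<union> T)"
  obtains A' where "A \<subseteq> A'" "A' \<subseteq> A \<union> T" "tight A'" "card A' = n"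
proof -
  have "\<exists>A'. A \<subseteq> A' \<and> A' \<subseteq> A \<union> T \<and> tight A' \<and> card A' = n"
    using A(3,4)
  proof (induction n rule: dec_induct)
    case base
    then show ?case using A by blast
  next
    case (step n)
    then obtain A' where A': "A \<subseteq> A'" "A' \<subseteq> A \<union> T" "tight A'" "card A' = n" by auto
    have fin: "finite A'" using A' finite_sub unfolding tight_def by blast
    \<comment> \<open>\<open>A'\<close> meets \<open>T\<close> without containing it, so
      connectivity of \<open>T\<close> yields an edge outside \<open>A'\<close> sharing at least two
      vertices with an edge inside; adding it preserves tightness.\<close>
    have "A' \<noteq> A \<union> T" using A' step by auto
    then obtain f where "f \<in> T" "f \<notin> A'" using A' by blast
    moreover obtain e where "e \<in> T" "e \<in> A'" using A A' by blast
    ultimately obtain e f where ef: "e \<in> T" "e \<in> A'" "f \<in> T" "f \<notin> A'" "card (e \<inter> f) \<ge> 2"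
      using connected_graph_cut[OF clusterD(3)[OF T]] by metis
    then have "tight (insert f A')" using tight_insert A' clusterD(1)[OF T] by blast
    moreover have "card (insert f A') = Suc n" using ef fin A' by simp
    ultimately show ?case using A' ef by (intro exI[of _ "insert f A'"]) auto
  qed
  then show thesis using that by blast
qed

text \<open>A cluster met but not contained in \<open>A\<close> supplies one more edge. Otherwise
  \<open>A\<close> is a union of whole clusters, and a merging pair leading out of it brings in the
  one or two edges that claim the pair on the far side.\<close>

lemma joined_extend:
  assumes C: "C \<subseteq> clusters" "joined (mergeable_12 r) C"
    and A: "tight A" "A \<subseteq> \<Union>C" "A \<noteq> \<Union>C"
  obtains A' where "A \<subseteq> A'" "A' \<subseteq> \<Union>C" "tight A'" "card A' = card A + 1 \<or> card A' = card A + 2"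
proof (cases "\<exists>T\<in>C. A \<inter> T \<noteq> {} \<and> \<not> T \<subseteq> A")
  case True
  then obtain T where T: "T \<in> C" "A \<inter> T \<noteq> {}" "\<not> T \<subseteq> A" by blast
  have finA: "finite A" using A(1) finite_sub unfolding tight_def by blast
  have "A \<subset> A \<union> T" using T by blast
  then have "card A < card (A \<union> T)"
    using finA T C clusterD(4) by (intro psubset_card_mono) auto
  then obtain A' where "A \<subseteq> A'" "A' \<subseteq> A \<union> T" "tight A'" "card A' = card A + 1"
    using tight_fill_cluster[of T A "card A + 1"] T C A by auto
  then show thesis using that[of A'] T A by blast
next
  case False
  let ?B = "{T \<in> C. T \<subseteq> A}"
  have AB: "A = \<Union>?B"
  proof
    show "A \<subseteq> \<Union>?B"
    proof
      fix e assume "e \<in> A"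
      moreover then obtain T where "T \<in> C" "e \<in> T" using A(2) by blast
      ultimately show "e \<in> \<Union>?B" using False by blast
    qed
  qed blast
  have "?B \<noteq> {}" using A(1) AB unfolding tight_def by blast
  moreover have "?B \<noteq> C" using AB A(3) by auto
  ultimately obtain X Y where XY: "X \<in> ?B" "Y \<in> C - ?B" "mergeable_12 r X Y"
    using joinedD[OF C(2), of ?B] by blast
  have "Y \<inter> A = {}" using XY False by blast
  have XYG: "X \<subseteq> G" "Y \<subseteq> G" using XY C clusterD(1) by blast+
  obtain E E' x y where E: "x \<noteq> y" "E \<subseteq> X" "E' \<subseteq> Y" "tight E" "tight E'"
    "{x, y} \<subseteq> \<Union>E" "{x, y} \<subseteq> \<Union>E'" "card E = 1 \<and> card E' = 2 \<or> card E = 2 \<and> card E' = 1"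
    by (rule mergeable_12E[OF XY(3) XYG])
  have disj: "A \<inter> E' = {}" using E(3) \<open>Y \<inter> A = {}\<close> by blast
  have "E \<subseteq> A" using E(2) XY(1) by blast
  then have "tight (A \<union> E')"
    using E by (intro tight_Un[OF A(1) E(5) disj E(1)]) auto
  moreover have "card (A \<union> E') = card A + card E'"
    using disj A(1) E(5) finite_sub unfolding tight_def by (intro card_Un_disjoint) auto
  ultimately show thesis using that[of "A \<union> E'"] E(3,8) XY(2) A(2) by auto
qed

text \<open>Steps have size at most two, so the target \<open>n\<close> is overshot by at most one
  edge.\<close>

lemma joined_fill:
  assumes C: "C \<subseteq> clusters" "joined (mergeable_12 r) C"
    and A: "tight A" "A \<subseteq> \<Union>C" "card A \<le> n + 1" "n \<le> card (\<Union>C)"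
  obtains A' where "A \<subseteq> A'" "A' \<subseteq> \<Union>C" "tight A'" "card A' = n \<or> card A' = n + 1"
proof -
  have "\<exists>A'. A \<subseteq> A' \<and> A' \<subseteq> \<Union>C \<and> tight A' \<and> (card A' = n \<or> card A' = n + 1)"
    using A
  proof (induction "n + 1 - card A" arbitrary: A rule: less_induct)
    case less
    show ?case
    proof (cases "card A \<ge> n")
      case True
      then show ?thesis using less.prems by (intro exI[of _ A]) auto
    next
      case False
      then have "A \<noteq> \<Union>C" using less.prems by auto
      then obtain B where B: "A \<subseteq> B" "B \<subseteq> \<Union>C" "tight B" "card B = card A + 1 \<or> card B = card A + 2"
        by (rule joined_extend[OF C less.prems(1,2)])
      then have "\<exists>A'. B \<subseteq> A' \<and> A' \<subseteq> \<Union>C \<and> tight A' \<and> (card A' = n \<or> card A' = n + 1)"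
        using False by (intro less.hyps) (auto simp: less.prems)
      then obtain A' where "B \<subseteq> A'" "A' \<subseteq> \<Union>C" "tight A'" "card A' = n \<or> card A' = n + 1"
        by (elim exE conjE)
      then show ?thesis using B(1) by (intro exI[of _ A'] conjI) auto
    qed
  qed
  then show thesis using that by blast
qed

text \<open>Growth starts at a single edge with the full size as target; a subset cannot overshoot
  it.\<close>

lemma joined_tight:
  assumes C: "C \<subseteq> clusters" "joined (mergeable_12 r) C"
  shows "tight (\<Union>C)"
proof -
  obtain T where "T \<in> C" using C(2) unfolding joined_def by blast
  then obtain e where e: "e \<in> \<Union>C" using clusterD(2) C(1) by blast
  have G: "\<Union>C \<subseteq> G" using Union_clusters_sub[OF C(1)] .
  have eG: "e \<in> G" and eC: "{e} \<subseteq> \<Union>C" "card {e} \<le> card (\<Union>C) + 1" using e G by auto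
  obtain A where "{e} \<subseteq> A" and A: "A \<subseteq> \<Union>C" "tight A"
    "card A = card (\<Union>C) \<or> card A = card (\<Union>C) + 1"
    by (rule joined_fill[OF C tight_edge[OF eG] eC order_refl])
  then have "A = \<Union>C"
    using card_subset_eq[OF finite_sub[OF G] A(1)] card_mono[OF finite_sub[OF G] A(1)] by auto
  then show ?thesis using A by simp
qed

section \<open>Flexible diamonds\<close>

text \<open>The claiming edges inside the union form a connected set, hence lie in one
  cluster.\<close>

lemma mergeable_cluster_of_union:
  assumes C: "C \<subseteq> clusters" and S: "S \<in> clusters" and m: "mergeable_12 r (\<Union>C) S"
  obtains T where "T \<in> C" "mergeable_12 r T S"
proof -
  have G: "\<Union>C \<subseteq> G" "S \<subseteq> G" using Union_clusters_sub[OF C] clusterD(1)[OF S] .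
  obtain E E' x y where E: "x \<noteq> y" "E \<subseteq> \<Union>C" "E' \<subseteq> S" "tight E" "tight E'"
    "{x, y} \<subseteq> \<Union>E" "{x, y} \<subseteq> \<Union>E'" "card E = 1 \<and> card E' = 2 \<or> card E = 2 \<and> card E' = 1"
    "\<Union>C \<inter> S = {}"
    by (rule mergeable_12E[OF m G])
  obtain e where e: "e \<in> E" using E(4) unfolding tight_def by blast
  then obtain T where T: "T \<in> C" "e \<in> T" using E(2) by blast
  have TG: "T \<subseteq> G" using T C clusterD(1) by blast
  have "connected_graph E" using tight_connected E(4,8) by auto
  moreover have "T \<in> clusters" "E \<inter> T \<noteq> {}" "E \<subseteq> G"
    using T C e E(4) unfolding tight_def by auto
  ultimately have ET: "E \<subseteq> T" using cluster_absorbs by blast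
  have "T \<inter> S = {}" using T E(9) by blast
  then have "mergeable_12 r T S"
    unfolding mergeable_12_iff[OF TG G(2)]
    by (intro conjI exI[of _ E] exI[of _ E'] exI[of _ x] exI[of _ y] ET E)
  then show thesis using that T by blast
qed

text \<open>Adding \<open>L\<close> to the tight graph \<open>\<Union>(C - {L})\<close> in small steps must avoid having exactly
  \<open>k\<close> edges, so \<open>L\<close> has to come in one step of size two.\<close>

lemma noncut_cluster_flexible:
  assumes C: "C \<subseteq> clusters" "card (\<Union>C) = k + 1" and L: "L \<in> C" "joined (mergeable_12 r) (C - {L})"
    and N: "N \<in> C - {L}" "mergeable_12 r N L"
  shows "flexible_diamond r (\<Union>C) L"
    and "\<exists>x y. x \<noteq> y \<and> not1_2_claims r L x y \<and> claims r 1 N x y"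
proof -
  let ?B = "\<Union>(C - {L})"
  have Lc: "L \<in> clusters" using C L by blast
  have B: "?B = \<Union>C - L" using Union_clusters_diff[OF C(1) Lc] .
  have tB: "tight ?B" using joined_tight L(2) C(1) by blast
  have LG: "L \<subseteq> G" and NG: "N \<subseteq> G" using C L N clusterD(1) by blast+
  have finL: "finite L" and finB: "finite ?B"
    using finite_sub LG tB unfolding tight_def by blast+
  have BL: "?B \<inter> L = {}" and BUL: "?B \<union> L = \<Union>C" using B L by auto
  have sum: "card ?B + card L = k + 1"
    using card_Un_disjoint[OF finB finL BL] C(2) BUL by simp
  obtain E E' x y where E: "x \<noteq> y" "E \<subseteq> N" "E' \<subseteq> L" "tight E" "tight E'"
    "{x, y} \<subseteq> \<Union>E" "{x, y} \<subseteq> \<Union>E'" "card E = 1 \<and> card E' = 2 \<or> card E = 2 \<and> card E' = 1"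
    by (rule mergeable_12E[OF N(2) NG LG])
  have NB: "N \<subseteq> ?B" using N by blast
  have "\<Union>E \<subseteq> \<Union>?B" by (rule Union_mono[OF subset_trans[OF E(2) NB]])
  then have xyB: "x \<in> \<Union>?B" "y \<in> \<Union>?B" using E(6) by (meson insertCI subsetD)+
  \<comment> \<open>An edge of \<open>L\<close> sharing two vertices with the rest could be added
    first, and then the other edges of \<open>L\<close> one at a time, passing through exactly
    \<open>k\<close> edges. If \<open>L\<close> is a single edge, the rest itself already has
    \<open>k\<close> edges.\<close>
  have no_edge: False if e: "e \<in> L" "u \<noteq> v" "{u, v} \<subseteq> e" "u \<in> \<Union>?B" "v \<in> \<Union>?B" for e u v
  proof -
    have tBe: "tight (?B \<union> {e})"
      by (rule tight_Un[OF tB tight_edge, of e u v]) (use e LG BL in auto)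
    have le: "card (?B \<union> {e}) \<le> k"
    proof (cases "card L = 1")
      case True
      then have "card ?B = k" using sum by simp
      then show ?thesis using tight_card_neq[OF tB] by simp
    next
      case False
      then have "card L \<ge> 2" using e(1) finL by (cases "card L") (auto simp: Suc_le_eq)
      then have "card ?B + 1 \<le> k" using sum by simp
      then show ?thesis using card_Un_le[of ?B "{e}"] by simp
    qed
    have "(?B \<union> {e}) \<union> L = \<Union>C" using BUL e(1) by blast
    then have ge: "k \<le> card (?B \<union> {e} \<union> L)" using C(2) by simp
    have ne: "(?B \<union> {e}) \<inter> L \<noteq> {}" using e(1) by blast
    obtain A' where "?B \<union> {e} \<subseteq> A'" "A' \<subseteq> ?B \<union> {e} \<union> L" "tight A'" "card A' = k"
      by (rule tight_fill_cluster[OF Lc tBe ne le ge])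
    then show False using tight_card_neq by blast
  qed
  have cE: "card E = 1" "card E' = 2"
  proof -
    have "card E' \<noteq> 1"
    proof
      assume "card E' = 1"
      then obtain e where "E' = {e}" by (rule card_1_singletonE)
      then show False using no_edge[of e x y] E xyB by auto
    qed
    then show "card E = 1" "card E' = 2" using E(8) by auto
  qed
  have "tight (?B \<union> E')"
    by (rule tight_Un[OF tB E(5), of x y]) (use E xyB BL in auto)
  \<comment> \<open>If \<open>E'\<close> were a proper part of \<open>L\<close>, adding it would
    give at most \<open>k\<close> edges, and filling up \<open>L\<close> edge by edge would again
    reach \<open>k\<close>.\<close>
  have "E' = L"
  proof (rule ccontr)
    assume "E' \<noteq> L"
    then have "card E' < card L" using E(3) finL by (intro psubset_card_mono) auto
    moreover have "card (?B \<union> E') = card ?B + card E'"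
      using finite_subset[OF E(3) finL] finB BL E(3) by (intro card_Un_disjoint) auto
    ultimately have le: "card (?B \<union> E') \<le> k" using sum by simp
    have "(?B \<union> E') \<union> L = \<Union>C" using BUL E(3) by blast
    then have ge: "k \<le> card (?B \<union> E' \<union> L)" using C(2) by simp
    have "E' \<noteq> {}" using cE(2) by auto
    then have ne: "(?B \<union> E') \<inter> L \<noteq> {}" using E(3) by blast
    obtain A' where "?B \<union> E' \<subseteq> A'" "A' \<subseteq> ?B \<union> E' \<union> L" "tight A'" "card A' = k"
      by (rule tight_fill_cluster[OF Lc \<open>tight (?B \<union> E')\<close> ne le ge])
    then show False using tight_card_neq by blast
  qed
  then obtain e f where ef: "L = {e, f}" "e \<noteq> f" using cE(2) unfolding card_2_iff by blast
  have "card (e \<inter> f) = 2" using tight_pair_card_Int ef E(5) \<open>E' = L\<close> by simp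
  then have dia: "diamond r L" using ef r_graph_sub[OF LG] unfolding diamond_def by blast
  have HL: "\<Union>C - L = ?B" using B by simp
  \<comment> \<open>At most one vertex by \<open>no_edge\<close>. At least one, because
    \<open>x\<close> and \<open>y\<close> are covered by the two edges of \<open>L\<close> and no
    edge contains both.\<close>
  have "card (g \<inter> \<Union>?B) = 1" if g: "g \<in> L" for g
  proof -
    have fin: "finite (g \<inter> \<Union>?B)" using g LG edge(1) by blast
    have "\<not> card (g \<inter> \<Union>?B) \<ge> 2"
    proof
      assume "card (g \<inter> \<Union>?B) \<ge> 2"
      then obtain u v where "u \<in> g \<inter> \<Union>?B" "v \<in> g \<inter> \<Union>?B" "u \<noteq> v"
        by (rule card_ge_2_obtain)
      then show False using no_edge[OF g, of u v] by simp
    qed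
    moreover have "\<not> {x, y} \<subseteq> h" if "h \<in> L" for h
      using no_edge[OF that E(1)] xyB by blast
    then have "x \<in> g \<or> y \<in> g" using E(7) g ef unfolding \<open>E' = L\<close> by auto
    then have "g \<inter> \<Union>?B \<noteq> {}" using xyB by blast
    then have "card (g \<inter> \<Union>?B) \<noteq> 0" using fin by simp
    ultimately show ?thesis by linarith
  qed
  then show "flexible_diamond r (\<Union>C) L"
    using dia L(1) unfolding flexible_diamond_def HL by blast
  have "2 \<in> claim_set r L x y" using claim_set_iff[OF LG, of 2] E \<open>E' = L\<close> cE by auto
  moreover have "1 \<notin> claim_set r L x y"
    unfolding claim_set_1_iff[OF LG] using no_edge[of _ x y] E(1) xyB by blast
  moreover have "1 \<in> claim_set r N x y" using claim_set_iff[OF NG, of 1] E cE by auto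
  ultimately show "\<exists>x y. x \<noteq> y \<and> not1_2_claims r L x y \<and> claims r 1 N x y"
    using E(1) unfolding not1_2_claims_def claims_def by blast
qed

text \<open>A flexible diamond touches the rest of \<open>H\<close> in one vertex per edge, so a
  merging pair must consist of these two vertices. No single edge of \<open>D\<close> contains both,
  so the neighbour \<open>Y\<close> is the side that 1-claims the pair.\<close>

lemma flexible_claim:
  assumes D: "flexible_diamond r H D" and H: "H \<subseteq> G" and Y: "Y \<subseteq> H" "mergeable_12 r Y D"
    and I: "I = \<Union>D \<inter> \<Union>(H - D)"
  obtains x y e where "x \<noteq> y" "I = {x, y}" "e \<in> Y" "{x, y} \<subseteq> e"
proof -
  have DG: "D \<subseteq> G" and YG: "Y \<subseteq> G" using D H Y unfolding flexible_diamond_def by auto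
  obtain E E' x y where "x \<noteq> y" "E \<subseteq> Y" "E' \<subseteq> D" "tight E" "tight E'"
    "{x, y} \<subseteq> \<Union>E" "{x, y} \<subseteq> \<Union>E'" "card E = 1 \<and> card E' = 2 \<or> card E = 2 \<and> card E' = 1"
    "Y \<inter> D = {}"
    by (rule mergeable_12E[OF Y(2) YG DG])
  note E = this(9,1,2,3,6,7,8)
  have YHD: "Y \<subseteq> H - D" using E(1) Y(1) by blast
  have xyV: "{x, y} \<subseteq> \<Union>(H - D)" using E(3,5) YHD by blast
  have one: "card (e \<inter> \<Union>(H - D)) = 1" if "e \<in> D" for e
    using D that unfolding flexible_diamond_def by blast
  have "card E' \<noteq> 1"
  proof
    assume "card E' = 1"
    then obtain e where e: "E' = {e}" by (rule card_1_singletonE)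
    then have "e \<in> D" using E(4) by simp
    then have "finite e" using DG edge(1) by blast
    then have "2 \<le> card (e \<inter> \<Union>(H - D))"
      using E(2,6) e xyV by (intro card_ge_2I[of _ x y]) auto
    then show False using one[OF \<open>e \<in> D\<close>] by simp
  qed
  then have "card E = 1" using E(7) by blast
  then obtain e where e: "E = {e}" by (rule card_1_singletonE)
  obtain g h where gh: "D = {g, h}"
    using D unfolding flexible_diamond_def diamond_def by blast
  obtain u where u: "g \<inter> \<Union>(H - D) = {u}" using card_1_singletonE[OF one] gh by blast
  obtain v where v: "h \<inter> \<Union>(H - D) = {v}" using card_1_singletonE[OF one] gh by blast
  have Iuv: "I = {u, v}" unfolding I using u v gh by auto
  have "{x, y} \<subseteq> I" unfolding I using E(4,6) xyV by blast
  then have "I = {x, y}" unfolding Iuv using E(2) by auto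
  then show thesis using that[of x y e] E(2,3,5) e by auto
qed

text \<open>All neighbours of \<open>D\<close> 1-claim the same pair, which only one cluster can
  do.\<close>

lemma flexible_leaf:
  assumes C: "C \<subseteq> clusters" and D: "flexible_diamond r (\<Union>C) D"
  shows "leaf (mergeable_12 r) C D"
  unfolding leaf_def
proof (intro ballI impI)
  fix Y Z assume YZ: "Y \<in> C" "Z \<in> C" "mergeable_12 r D Y" "mergeable_12 r D Z"
  note m = YZ(3,4)[THEN sympD[OF symp_mergeable_12]]
  note G = Union_clusters_sub[OF C]
  obtain x y e where 1: "x \<noteq> y" "\<Union>D \<inter> \<Union>(\<Union>C - D) = {x, y}" "e \<in> Y" "{x, y} \<subseteq> e"
    by (rule flexible_claim[OF D G _ m(1) refl]) (use YZ in auto)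
  obtain x' y' f where 2: "x' \<noteq> y'" "\<Union>D \<inter> \<Union>(\<Union>C - D) = {x', y'}" "f \<in> Z" "{x', y'} \<subseteq> f"
    by (rule flexible_claim[OF D G _ m(2) refl]) (use YZ in auto)
  have "{x, y} \<subseteq> f" using 1(2) 2(2,4) by simp
  show "Y = Z"
    by (rule cluster_unique_pair[OF subsetD[OF C YZ(1)] subsetD[OF C YZ(2)] 1(3) 2(3) 1(1,4)
      \<open>{x, y} \<subseteq> f\<close>])
qed

lemma card_flexible: "flexible_diamond r H D \<Longrightarrow> card D = 2"
  unfolding flexible_diamond_def diamond_def card_2_iff by blast

text \<open>Tight sets on both sides containing the claiming edges can be glued together, so their
  sizes must never add up to \<open>k\<close>; any size of \<open>S\<close> other than 2 makes this
  sum attainable.\<close>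

lemma new_cluster_card:
  assumes C: "C \<subseteq> clusters" "joined (mergeable_12 r) C" "card (\<Union>C) = k - 1"
    and S: "S \<in> clusters" "S \<notin> C" and T: "T \<in> C" "mergeable_12 r T S"
  shows "card S = 2"
proof (rule ccontr)
  assume S2: "card S \<noteq> 2"
  have TG: "T \<subseteq> G" and SG: "S \<subseteq> G" using T C S clusterD(1) by blast+
  have CG: "\<Union>C \<subseteq> G" using Union_clusters_sub[OF C(1)] .
  have disj: "\<Union>C \<inter> S = {}" using cluster_disjoint C(1) S by blast
  obtain E E' x y where E: "x \<noteq> y" "E \<subseteq> T" "E' \<subseteq> S" "tight E" "tight E'"
    "{x, y} \<subseteq> \<Union>E" "{x, y} \<subseteq> \<Union>E'" "card E = 1 \<and> card E' = 2 \<or> card E = 2 \<and> card E' = 1"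
    by (rule mergeable_12E[OF T(2) TG SG])
  have EC: "E \<subseteq> \<Union>C" using E(2) T(1) by blast
  have glue: "card A + card A' \<noteq> k" if A: "tight A" "E \<subseteq> A" "A \<subseteq> \<Union>C" "tight A'" "E' \<subseteq> A'" "A' \<subseteq> S"
    for A A'
  proof -
    have dj: "A \<inter> A' = {}" using A disj by blast
    have "tight (A \<union> A')"
      by (rule tight_Un[OF A(1,4) dj E(1)]) (use E A in auto)
    moreover have "card (A \<union> A') = card A + card A'"
      using A CG SG dj by (intro card_Un_disjoint finite_sub) auto
    ultimately show ?thesis using tight_card_neq by fastforce
  qed
  have tC: "tight (\<Union>C)" using joined_tight C by blast
  \<comment> \<open>A single claiming edge of \<open>S\<close> would complete the
    \<open>k - 1\<close> edges of \<open>\<Union>C\<close> to \<open>k\<close>.\<close>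
  have "card E' \<noteq> 1"
    using glue[OF tC EC subset_refl E(5) subset_refl E(3)] C(3) k_ge_3 by auto
  then have cE: "card E = 1" "card E' = 2" using E(8) by auto
  have "card E' \<le> card S" using E(3) clusterD(4)[OF S(1)] by (rule card_mono[rotated])
  then have "3 \<le> card S" using cE S2 by simp
  moreover have "E' \<union> S = S" using E(3) by blast
  ultimately have ge: "3 \<le> card (E' \<union> S)" and le: "card E' \<le> 3" using cE by simp_all
  have "E' \<noteq> {}" using cE by auto
  then have ne: "E' \<inter> S \<noteq> {}" using E(3) by blast
  obtain E'' where E'': "E' \<subseteq> E''" "E'' \<subseteq> S" "tight E''" "card E'' = 3"
    by (rule tight_fill_cluster[OF S(1) E(5) ne le ge, unfolded \<open>E' \<union> S = S\<close>])
  \<comment> \<open>Growing \<open>E\<close> inside \<open>\<Union>C\<close> reaches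
    \<open>k - 3\<close> or \<open>k - 2\<close> edges; three edges of \<open>S\<close> complete the
    first to \<open>k\<close>, the two edges of \<open>E'\<close> the second.\<close>
  have k3: "card E \<le> k - 3 + 1" "k - 3 \<le> card (\<Union>C)" using cE C(3) k_ge_3 by simp_all
  obtain A where A: "E \<subseteq> A" "A \<subseteq> \<Union>C" "tight A" "card A = k - 3 \<or> card A = k - 3 + 1"
    by (rule joined_fill[OF C(1,2) E(4) EC k3])
  then show False
    using glue[OF A(3,1,2) E(5) subset_refl E(3)] glue[OF A(3,1,2) E''(3,1,2)] cE E''(4) k_ge_3
    by auto
qed

section \<open>Witnesses for property P\<close>

text \<open>The data that Property P demands for one cluster \<open>T0\<close>, named so that it can
  be built and taken apart.\<close>

definition witness :: "'a set set \<Rightarrow> 'a set set \<Rightarrow> nat \<Rightarrow> (nat \<Rightarrow> 'a set set) \<Rightarrow> 'a set set \<Rightarrow> bool" where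
  "witness F T0 l T H \<longleftrightarrow> l \<ge> 1 \<and> (\<forall>p\<in>{1..l}. T p \<in> one_clusters G) \<and> merge_in_order r l T \<and>
     H = (\<Union>p\<in>{1..l}. T p) \<and> H \<subseteq> F \<and> card H = k + 1 \<and> T0 \<in> T ` {1..l} \<and>
     flexible_diamond r H (T 1) \<and> flexible_diamond r H (T l) \<and>
     (\<exists>x y. x \<noteq> y \<and> not1_2_claims r (T 1) x y \<and> claims r 1 (T 2) x y) \<and>
     (\<exists>x y. x \<noteq> y \<and> not1_2_claims r (T l) x y \<and> claims r 1 (T (l - 1)) x y)"

lemma property_P_iff:
  "property_P r k G F \<longleftrightarrow> (\<forall>T0\<in>clusters. T0 \<subseteq> F \<longrightarrow> (\<exists>l T H. witness F T0 l T H))"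
  unfolding property_P_def witness_def ..

text \<open>Neither end of the enumeration is a cut vertex: the first by hypothesis, the last
  because what precedes it is itself a growing enumeration. As the union has \<open>k + 1\<close>
  edges, \<open>noncut_cluster_flexible\<close> makes both ends flexible diamonds with the required
  claims.\<close>

lemma growing_witness:
  assumes cs: "growing (mergeable_12 r) (ws @ [Y, Z])" "ws \<noteq> []" "set (ws @ [Y, Z]) = C"
    and C: "C \<subseteq> clusters" "card (\<Union>C) = k + 1" "\<Union>C \<subseteq> F" "T0 \<in> C"
    and hd: "joined (mergeable_12 r) (C - {hd ws})" and YZ: "mergeable_12 r Y Z"
  shows "\<exists>l T H. witness F T0 l T H"
proof -
  let ?cs = "ws @ [Y, Z]"
  define l where "l = length ?cs"
  \<comment> \<open>Sequences in Property P count from 1, list positions from 0.\<close>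
  define T where "T p = ?cs ! (p - 1)" for p
  obtain X vs where ws: "ws = X # vs" using cs(2) by (cases ws) auto
  have l3: "l \<ge> 3" unfolding l_def ws by simp
  have dist: "distinct ?cs" using cs(1) unfolding growing_def by blast
  have img: "T ` {1..n} = set (take n ?cs)" if "n \<le> l" for n
  proof -
    have "T ` {1..n} = (!) ?cs ` ((\<lambda>p. p - 1) ` {1..n})" unfolding T_def by (simp add: image_image)
    also have "(\<lambda>p. p - 1) ` {1..n} = {0..<n}"
    proof
      show "{0..<n} \<subseteq> (\<lambda>p. p - 1) ` {1..n}"
      proof
        fix j assume "j \<in> {0..<n}"
        then show "j \<in> (\<lambda>p. p - 1) ` {1..n}" by (intro image_eqI[of _ _ "Suc j"]) auto
      qed
    qed auto
    also have "(!) ?cs ` {0..<n} = set (take n ?cs)"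
      using that nth_image[of n ?cs] unfolding l_def by simp
    finally show ?thesis .
  qed
  have imgC: "T ` {1..l} = C" using img[of l] cs(3) unfolding l_def by simp
  have T1: "T 1 = X" unfolding T_def ws by simp
  have Tl: "T l = Z" unfolding T_def l_def by (simp add: nth_append)
  have Tl1: "T (l - 1) = Y" unfolding T_def l_def by (simp add: nth_append)
  have Tc: "T p \<in> C" if "p \<in> {1..l}" for p using that imgC by blast
  have inj: "inj_on T {1..l}"
  proof (rule inj_onI)
    fix p q assume pq: "p \<in> {1..l}" "q \<in> {1..l}" "T p = T q"
    then have "p - 1 = q - 1"
      using nth_eq_iff_index_eq[OF dist, of "p - 1" "q - 1"] unfolding T_def l_def by auto
    then show "p = q" using pq by auto
  qed
  have step: "\<exists>q\<in>{1..p - 1}. mergeable_12 r (T q) (T p)" if p: "p \<in> {2..l}" for p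
  proof -
    have "p - 1 < length ?cs" "0 < p - 1" using p unfolding l_def by auto
    then obtain j where j: "j < p - 1" "mergeable_12 r (?cs ! j) (?cs ! (p - 1))"
      using cs(1) unfolding growing_def by blast
    then have "mergeable_12 r (T (j + 1)) (T p)" unfolding T_def by simp
    moreover have "j + 1 \<in> {1..p - 1}" using j by simp
    ultimately show ?thesis by blast
  qed
  have "merge_in_order r l T"
    unfolding merge_in_order_def
  proof
    fix p assume p: "p \<in> {2..l}"
    obtain q where q: "q \<in> {1..p - 1}" "mergeable_12 r (T q) (T p)" using step[OF p] by blast
    have "T p' \<inter> T p = {}" if p': "p' \<in> {1..p - 1}" for p'
    proof -
      have "p' \<in> {1..l}" "p \<in> {1..l}" "p' \<noteq> p" using p p' by auto
      then have "T p' \<noteq> T p" using inj_onD[OF inj, of p' p] by blast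
      then show ?thesis
        using cluster_disjoint[of "T p'" "T p"] Tc[OF \<open>p' \<in> {1..l}\<close>] Tc[OF \<open>p \<in> {1..l}\<close>] C(1) by blast
    qed
    then have disj: "(\<Union>p'\<in>{1..p - 1}. T p') \<inter> T p = {}" by blast
    have "T q \<subseteq> (\<Union>p'\<in>{1..p - 1}. T p')" using q(1) by blast
    then show "mergeable_12 r (\<Union>p'\<in>{1..p - 1}. T p') (T p)"
      by (rule mergeable_12_mono[OF q(2) _ subset_refl disj])
  qed
  moreover have H: "\<Union>C = (\<Union>p\<in>{1..l}. T p)" using imgC by blast
  moreover have first: "flexible_diamond r (\<Union>C) (T 1)"
    "\<exists>x y. x \<noteq> y \<and> not1_2_claims r (T 1) x y \<and> claims r 1 (T 2) x y"
  proof -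
    \<comment> \<open>The second entry must attach to an earlier one, and there is only the
      first.\<close>
    have "mergeable_12 r (T 1) (T 2)"
    proof -
      obtain q where "q \<in> {1..2 - 1}" "mergeable_12 r (T q) (T 2)" using step[of 2] l3 by auto
      then show ?thesis by simp
    qed
    then have m: "mergeable_12 r (T 2) (T 1)" using symp_mergeable_12 by (rule sympD[rotated])
    have "T 1 \<noteq> T 2" using inj_onD[OF inj, of 1 2] l3 by auto
    then have N: "T 2 \<in> C - {T 1}" using Tc[of 2] l3 by auto
    have "joined (mergeable_12 r) (C - {T 1})" using hd unfolding T1 ws by simp
    from noncut_cluster_flexible[OF C(1,2) _ this N m]
    show "flexible_diamond r (\<Union>C) (T 1)"
      "\<exists>x y. x \<noteq> y \<and> not1_2_claims r (T 1) x y \<and> claims r 1 (T 2) x y"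
      using Tc[of 1] l3 by auto
  qed
  moreover have last: "flexible_diamond r (\<Union>C) (T l)"
    "\<exists>x y. x \<noteq> y \<and> not1_2_claims r (T l) x y \<and> claims r 1 (T (l - 1)) x y"
  proof -
    have "growing (mergeable_12 r) ((ws @ [Y]) @ [Z])" using cs(1) by simp
    then have "growing (mergeable_12 r) (ws @ [Y])"
      using growing_snoc[of "ws @ [Y]" "mergeable_12 r" Z] by simp
    then have "joined (mergeable_12 r) (set (ws @ [Y]))"
      by (rule growing_joined[OF symp_mergeable_12]) simp
    moreover have "set (ws @ [Y]) = C - {Z}" unfolding cs(3)[symmetric] using dist by auto
    ultimately have j: "joined (mergeable_12 r) (C - {Z})" by simp
    have "Z \<in> C" "Y \<in> C - {Z}" unfolding cs(3)[symmetric] using dist by auto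
    from noncut_cluster_flexible[OF C(1,2) this(1) j this(2) YZ]
    show "flexible_diamond r (\<Union>C) (T l)"
      "\<exists>x y. x \<noteq> y \<and> not1_2_claims r (T l) x y \<and> claims r 1 (T (l - 1)) x y"
      unfolding Tl Tl1 by auto
  qed
  ultimately have "witness F T0 l T (\<Union>C)"
    using l3 Tc C imgC unfolding witness_def by auto
  then show ?thesis by blast
qed

text \<open>Collects the hypotheses of \<open>exchange_leaf\<close>, with \<open>T 1\<close> and
  \<open>T l\<close> as the two ends and \<open>T (l - 1)\<close> as the neighbour of the
  second.\<close>

lemma witness_extract:
  assumes W: "witness F T0 l T H"
  defines "C \<equiv> T ` {1..l}" and "R \<equiv> mergeable_12 r"
  shows "C \<subseteq> clusters" "finite C" "joined R C" "T 1 \<in> C" "T l \<in> C" "T (l - 1) \<in> C"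
    "T 1 \<noteq> T l" "T (l - 1) \<noteq> T 1" "T (l - 1) \<noteq> T l" "R (T (l - 1)) (T l)"
    "leaf R C (T 1)" "leaf R C (T l)" "joined R (C - {T l, T (l - 1)})"
proof -
  have l1: "l \<ge> 1" and Tc: "\<And>p. p \<in> {1..l} \<Longrightarrow> T p \<in> clusters" and mo: "merge_in_order r l T"
    and H: "H = \<Union>C" and card: "card H = k + 1"
    and f1: "flexible_diamond r H (T 1)" and fl: "flexible_diamond r H (T l)"
    using W unfolding witness_def C_def by auto
  show Cc: "C \<subseteq> clusters" using Tc unfolding C_def by blast
  show finC: "finite C" unfolding C_def by simp
  have symR: "symp R" unfolding R_def by (rule symp_mergeable_12)
  have HG: "H \<subseteq> G" unfolding H using Union_clusters_sub[OF Cc] .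
  \<comment> \<open>A single diamond has two edges, too few for \<open>k + 1\<close>.\<close>
  have "l \<noteq> 1"
  proof
    assume "l = 1"
    then have "H = T 1" unfolding H C_def by simp
    then show False using card card_flexible[OF f1] k_ge_3 by simp
  qed
  then have l2: "l \<ge> 2" using l1 by simp
  have step: "\<exists>q\<in>{1..p - 1}. R (T q) (T p)" and disj: "\<forall>q\<in>{1..p - 1}. T q \<inter> T p = {}"
    if p: "p \<in> {2..l}" for p
  proof -
    have m: "mergeable_12 r (\<Union>(T ` {1..p - 1})) (T p)" using mo p unfolding merge_in_order_def by auto
    have sub: "T ` {1..p - 1} \<subseteq> clusters" and Tp: "T p \<in> clusters" using Tc p by auto
    from mergeable_cluster_of_union[OF sub Tp m]
    show "\<exists>q\<in>{1..p - 1}. R (T q) (T p)" unfolding R_def by blast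
    show "\<forall>q\<in>{1..p - 1}. T q \<inter> T p = {}"
      using m unfolding mergeable_12_def mergeable_via_def by blast
  qed
  have neq: "T q \<noteq> T p" if "1 \<le> q" "q < p" "p \<le> l" for p q
  proof -
    have "T q \<inter> T p = {}" using bspec[OF disj[of p], of q] that by auto
    moreover have "T p \<noteq> {}" using clusterD(2)[OF Tc, of p] that by simp
    ultimately show ?thesis by auto
  qed
  have joined_prefix: "joined R (T ` {1..n})" if "1 \<le> n" "n \<le> l" for n
    using that
  proof (induction n rule: dec_induct)
    case base
    then show ?case by (simp add: joined_singleton)
  next
    case (step n)
    obtain q where "q \<in> {1..n}" "R (T q) (T (Suc n))" using \<open>Suc n \<le> l\<close> step.hyps
      \<open>\<And>p. p \<in> {2..l} \<Longrightarrow> \<exists>q\<in>{1..p - 1}. R (T q) (T p)\<close>[of "Suc n"] by auto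
    then have "joined R (insert (T (Suc n)) (T ` {1..n}))"
      using joined_insert[of R "T ` {1..n}" "T q" "T (Suc n)"] step
        symR by simp
    then show ?case by (simp add: atLeastAtMostSuc_conv)
  qed
  show "joined R C" unfolding C_def using joined_prefix[of l] l1 by simp
  show in1: "T 1 \<in> C" and inl: "T l \<in> C" and inm: "T (l - 1) \<in> C"
    unfolding C_def using l2 by auto
  show "T 1 \<noteq> T l" using neq[of 1 l] l2 by simp
  show mneq: "T (l - 1) \<noteq> T l" using neq[of "l - 1" l] l2 by simp
  show "leaf R C (T 1)" "leaf R C (T l)"
    using flexible_leaf[OF Cc] f1 fl unfolding R_def H by blast+
  have G: "T p \<subseteq> G" if "p \<in> {1..l}" for p using Tc that clusterD(1) by blast
  \<comment> \<open>If \<open>l = 2\<close>, the pair claimed by \<open>T 1\<close> would lie in one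
    edge of \<open>T 2\<close>, which would then meet the rest of \<open>H\<close> in two vertices,
    against flexibility of \<open>T 2\<close>.\<close>
  have l3: "l \<ge> 3"
  proof (rule ccontr)
    assume "\<not> l \<ge> 3"
    then have l: "l = 2" using l2 by simp
    obtain x y where xy: "x \<noteq> y" "not1_2_claims r (T 1) x y" "claims r 1 (T 2) x y"
      using W unfolding witness_def by blast
    have G12: "T 1 \<subseteq> G" "T 2 \<subseteq> G" using G[of 1] G[of 2] l by auto
    have "\<exists>e\<in>T 2. x \<in> e \<and> y \<in> e"
      using xy(3) unfolding claims_def claim_set_1_iff[OF G12(2)] .
    then obtain e where e: "e \<in> T 2" "x \<in> e" "y \<in> e" by blast
    have "2 \<in> claim_set r (T 1) x y" using xy(2) unfolding not1_2_claims_def by simp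
    then have "\<exists>E\<subseteq>T 1. card E = 2 \<and> tight E \<and> x \<in> \<Union>E \<and> y \<in> \<Union>E"
      by (rule iffD1[OF claim_set_iff[OF G12(1)], rotated]) simp
    then obtain E where E: "E \<subseteq> T 1" "x \<in> \<Union>E" "y \<in> \<Union>E" by (elim exE conjE)
    have "T 1 \<subseteq> H - T 2"
      using disj[of 2] in1 l unfolding H by auto
    then have "{x, y} \<subseteq> e \<inter> \<Union>(H - T 2)" using E e by blast
    moreover have "finite e" using e G12 edge(1) by blast
    ultimately have "2 \<le> card (e \<inter> \<Union>(H - T 2))"
      using xy(1) by (intro card_ge_2I[of _ x y]) auto
    then show False using fl e(1) l unfolding flexible_diamond_def by auto
  qed
  have "(1::nat) < l - 1" using l3 by simp
  then show "T (l - 1) \<noteq> T 1" using neq[of 1 "l - 1"] by auto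
  show "R (T (l - 1)) (T l)"
  proof -
    obtain x y where xy: "x \<noteq> y" "not1_2_claims r (T l) x y" "claims r 1 (T (l - 1)) x y"
      using W unfolding witness_def by blast
    moreover have "T (l - 1) \<inter> T l = {}" using disj[of l] l3 by auto
    ultimately show ?thesis
      unfolding R_def mergeable_12_def mergeable_via_def not1_2_claims_def claims_def by blast
  qed
  \<comment> \<open>Without its last two members the sequence is a prefix, and prefixes are
    connected.\<close>
  have "T ` {1..l - 2} = C - {T l, T (l - 1)}"
  proof -
    have "{1..l} = {1..l - 2} \<union> {l - 1, l}" using l3 by auto
    then have "C = T ` {1..l - 2} \<union> {T (l - 1), T l}" unfolding C_def by auto
    moreover have "T (l - 1) \<notin> T ` {1..l - 2}" "T l \<notin> T ` {1..l - 2}"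
      using neq[of _ "l - 1"] neq[of _ l] l3 by fastforce+
    ultimately show ?thesis by blast
  qed
  then show "joined R (C - {T l, T (l - 1)})" using joined_prefix[of "l - 2"] l3 by simp
qed

text \<open>\<open>S\<close> merges with some 1-cluster \<open>T\<close> inside \<open>F\<close>. In
  a witness for \<open>T\<close>, one end other than \<open>T\<close> is exchanged for
  \<open>S\<close>; this forces \<open>card S = 2\<close> and preserves the total of
  \<open>k + 1\<close> edges.\<close>

lemma property_P_add_cluster:
  assumes P: "property_P r k G F" and F: "\<And>T. T \<in> clusters \<Longrightarrow> T \<inter> F \<noteq> {} \<Longrightarrow> T \<subseteq> F"
    and FG: "F \<subseteq> G"
    and S: "S \<in> clusters" "\<not> S \<subseteq> F" and m: "mergeable_12 r F S"
  shows "card S = 2 \<and> property_P r k G (F \<union> S)"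
proof -
  have "F = \<Union>{T \<in> clusters. T \<subseteq> F}"
  proof
    show "F \<subseteq> \<Union>{T \<in> clusters. T \<subseteq> F}"
    proof
      fix e assume "e \<in> F"
      then obtain T where "T \<in> clusters" "e \<in> T" using cluster_cover FG by blast
      then show "e \<in> \<Union>{T \<in> clusters. T \<subseteq> F}" using F[of T] \<open>e \<in> F\<close> by blast
    qed
  qed blast
  then have mU: "mergeable_12 r (\<Union>{T \<in> clusters. T \<subseteq> F}) S" using m by simp
  obtain T where "T \<in> {T \<in> clusters. T \<subseteq> F}" "mergeable_12 r T S"
    by (rule mergeable_cluster_of_union[OF _ S(1) mU]) auto
  then have T: "T \<in> clusters" "T \<subseteq> F" "mergeable_12 r T S" by auto
  obtain l U H where W: "witness F T l U H" using P T unfolding property_P_iff by blast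
  define C where "C = U ` {1..l}"
  note ex = witness_extract[OF W, folded C_def]
  have H: "H = \<Union>C" "H \<subseteq> F" "card H = k + 1" "T \<in> C"
    "flexible_diamond r H (U 1)" "flexible_diamond r H (U l)"
    using W unfolding witness_def C_def by auto
  have SC: "S \<notin> C" using S H by blast
  \<comment> \<open>\<open>D \<noteq> T\<close> leaves \<open>T\<close> in \<open>C - {D}\<close>,
    whose \<open>k - 1\<close> edges are what \<open>new_cluster_card\<close> needs.\<close>
  obtain D ws Y Z where D: "D \<in> {U 1, U l}" "D \<noteq> T" "ws \<noteq> []"
    "growing (mergeable_12 r) (ws @ [Y, Z])" "set (ws @ [Y, Z]) = insert S (C - {D})"
    "joined (mergeable_12 r) (insert S (C - {D}) - {hd ws})" "mergeable_12 r Y Z"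
    by (rule exchange_leaf[OF symp_mergeable_12 ex(2,3,4,5,6,7,8,9,10,11,12,13) H(4) SC T(3)])
  have DC: "D \<in> C" "card D = 2" using D(1) ex(4,5) card_flexible H(5,6) by auto
  have lD: "leaf (mergeable_12 r) C D" using D(1) ex(11,12) by blast
  have jCD: "joined (mergeable_12 r) (C - {D})"
    by (rule joined_remove_leaf[OF symp_mergeable_12 ex(3) lD]) (use ex(4,5,7) in auto)
  have sub: "C - {D} \<subseteq> clusters" using ex(1) by blast
  have CG: "\<Union>(C - {D}) \<subseteq> G" using Union_clusters_sub[OF sub] .
  have UD: "\<Union>(C - {D}) = \<Union>C - D"
    using Union_clusters_diff[OF ex(1)] DC(1) ex(1) by blast
  have cardCD: "card (\<Union>(C - {D})) = k - 1"
  proof -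
    have "D \<subseteq> \<Union>C" "finite D" using DC ex(1) clusterD(4) by blast+
    then have "card (\<Union>C - D) = card (\<Union>C) - card D" by (simp add: card_Diff_subset)
    then show ?thesis unfolding UD using H DC by simp
  qed
  have S2: "card S = 2"
    by (rule new_cluster_card[OF sub jCD cardCD S(1), of T]) (use SC T H D in auto)
  have disj: "\<Union>(C - {D}) \<inter> S = {}" using cluster_disjoint sub S(1) SC by blast
  have "card (\<Union>(C - {D}) \<union> S) = k + 1"
    using card_Un_disjoint[OF finite_sub[OF CG] clusterD(4)[OF S(1)] disj] cardCD S2 k_ge_3 by simp
  then have cardS: "card (\<Union>(insert S (C - {D}))) = k + 1" by (simp add: Un_commute)
  have WS: "\<exists>l T H. witness (F \<union> S) S l T H"
    by (rule growing_witness[OF D(4,3,5) _ cardS _ _ D(6,7)]) (use S(1) sub H in auto)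
  \<comment> \<open>Only \<open>S\<close> needs a new witness; a witness inside \<open>F\<close>
    remains one inside \<open>F \<union> S\<close>.\<close>
  have "\<exists>l T H. witness (F \<union> S) T0 l T H" if T0: "T0 \<in> clusters" "T0 \<subseteq> F \<union> S" for T0
  proof (cases "T0 = S")
    case True
    then show ?thesis using WS by simp
  next
    case False
    then have "T0 \<subseteq> F" using cluster_disjoint[OF T0(1) S(1)] T0 by blast
    then obtain l T H where "witness F T0 l T H" using P T0 unfolding property_P_iff by blast
    then have "witness (F \<union> S) T0 l T H" unfolding witness_def by auto
    then show ?thesis by blast
  qed
  then show ?thesis using S2 unfolding property_P_iff by blast
qed

section \<open>The merging process\<close>

text \<open>Invariant of the merging stages; its last clause says that no 1-cluster is split between
  parts.\<close>

definition cluster_partition :: "'a set set set \<Rightarrow> bool" where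
  "cluster_partition P \<longleftrightarrow> (\<forall>A\<in>P. A \<noteq> {} \<and> A \<subseteq> G) \<and> (\<forall>A\<in>P. \<forall>B\<in>P. A \<noteq> B \<longrightarrow> A \<inter> B = {}) \<and>
     (\<forall>A\<in>P. \<forall>T\<in>clusters. T \<inter> A \<noteq> {} \<longrightarrow> T \<subseteq> A)"

lemma cluster_partition_clusters: "cluster_partition clusters"
  unfolding cluster_partition_def
proof (intro conjI ballI impI)
  fix A T assume "A \<in> clusters" "T \<in> clusters" "T \<inter> A \<noteq> {}"
  then show "T \<subseteq> A" using cluster_disjoint[of T A] by auto
qed (use clusterD(1,2) cluster_disjoint in blast)+

lemma cluster_partition_step:
  assumes "cluster_partition P" "merge_step r P Q"
  shows "cluster_partition Q" "\<forall>A\<in>P. \<exists>B\<in>Q. A \<subseteq> B"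
proof -
  obtain A B where AB: "A \<in> P" "B \<in> P" "Q = insert (A \<union> B) (P - {A, B})"
    using assms(2) unfolding merge_step_def by blast
  show "\<forall>X\<in>P. \<exists>Y\<in>Q. X \<subseteq> Y"
  proof
    fix X assume "X \<in> P"
    then have "X \<in> {A, B} \<or> X \<in> Q" unfolding AB(3) by blast
    moreover have "A \<union> B \<in> Q" unfolding AB(3) by simp
    ultimately show "\<exists>Y\<in>Q. X \<subseteq> Y" by auto
  qed
  have P: "X \<noteq> {}" "X \<subseteq> G" "\<And>T. T \<in> clusters \<Longrightarrow> T \<inter> X \<noteq> {} \<Longrightarrow> T \<subseteq> X" if "X \<in> P" for X
    using assms(1) that unfolding cluster_partition_def by simp_all
  have disj: "X \<inter> Y = {}" if "X \<in> P" "Y \<in> P" "X \<noteq> Y" for X Y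
    using assms(1) that unfolding cluster_partition_def by simp
  have UX: "(A \<union> B) \<inter> X = {}" if "X \<in> P - {A, B}" for X
    using disj[OF AB(1), of X] disj[OF AB(2), of X] that by auto
  show "cluster_partition Q"
    unfolding cluster_partition_def AB(3)
  proof (intro conjI ballI impI)
    fix X assume "X \<in> insert (A \<union> B) (P - {A, B})"
    then show "X \<noteq> {}" "X \<subseteq> G" using P(1,2) AB(1,2) by auto
    fix T assume T: "T \<in> clusters" "T \<inter> X \<noteq> {}"
    show "T \<subseteq> X"
    proof (cases "X = A \<union> B")
      case True
      then have "T \<inter> A \<noteq> {} \<or> T \<inter> B \<noteq> {}" using T(2) by blast
      then show ?thesis using P(3)[OF AB(1) T(1)] P(3)[OF AB(2) T(1)] True by auto
    next
      case False
      then show ?thesis using \<open>X \<in> insert (A \<union> B) (P - {A, B})\<close> P(3)[OF _ T] by simp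
    qed
  next
    fix X Y assume "X \<in> insert (A \<union> B) (P - {A, B})" "Y \<in> insert (A \<union> B) (P - {A, B})" "X \<noteq> Y"
    then consider "X = A \<union> B" "Y \<in> P - {A, B}" | "Y = A \<union> B" "X \<in> P - {A, B}" | "X \<in> P" "Y \<in> P"
      by blast
    then show "X \<inter> Y = {}"
      by cases (use UX[of X] UX[of Y] disj[of X Y] \<open>X \<noteq> Y\<close> in \<open>simp_all add: Int_commute\<close>)
  qed
qed

text \<open>That \<open>F\<close> and \<open>F \<union> S\<close> are both partial 2-clusters does
  not say that \<open>F\<close> and \<open>S\<close> were merged with each other. The step that
  first creates \<open>F \<union> S\<close> shows it.\<close>

lemma merged_cluster_mergeable:
  assumes TC: "two_clustering r G M2 M2'" and F: "F \<in> M2'"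
    and S: "S \<in> clusters" "\<not> S \<subseteq> F" "F \<union> S \<in> M2'"
  shows "mergeable_12 r F S" "F \<subseteq> G" "\<And>T. T \<in> clusters \<Longrightarrow> T \<inter> F \<noteq> {} \<Longrightarrow> T \<subseteq> F"
proof -
  obtain Ps where Ps: "merging_process r G Ps" "M2' = \<Union>(set Ps)"
    using TC unfolding two_clustering_def by blast
  have ne: "Ps \<noteq> []" and P0: "Ps ! 0 = clusters"
    and succ: "\<And>i. Suc i < length Ps \<Longrightarrow> merge_step r (Ps ! i) (Ps ! Suc i)"
    using Ps(1) unfolding merging_process_def successively_conv_nth by (auto simp: hd_conv_nth)
  have part: "cluster_partition (Ps ! i)" if "i < length Ps" for i
    using that
  proof (induction i)
    case 0
    then show ?case using P0 cluster_partition_clusters by simp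
  next
    case (Suc i)
    then show ?case using cluster_partition_step(1) succ by auto
  qed
  have refine: "\<exists>B\<in>Ps ! j. A \<subseteq> B" if "i \<le> j" "j < length Ps" "A \<in> Ps ! i" for i j A
    using that(1,2)
  proof (induction j rule: dec_induct)
    case base
    then show ?case using that(3) by blast
  next
    case (step j)
    then obtain B where B: "B \<in> Ps ! j" "A \<subseteq> B" by auto
    have "cluster_partition (Ps ! j)" "merge_step r (Ps ! j) (Ps ! Suc j)"
      using part[of j] succ[of j] step.prems by simp_all
    then obtain B' where "B' \<in> Ps ! Suc j" "B \<subseteq> B'" using cluster_partition_step(2) B(1) by blast
    then show ?case using B(2) by blast
  qed
  obtain i where i: "i < length Ps" "F \<in> Ps ! i" using F Ps(2) by (auto simp: in_set_conv_nth)
  have Fprop: "F \<noteq> {}" "F \<subseteq> G" "\<And>T. T \<in> clusters \<Longrightarrow> T \<inter> F \<noteq> {} \<Longrightarrow> T \<subseteq> F"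
    using part[OF i(1)] i(2) unfolding cluster_partition_def by simp_all
  show "F \<subseteq> G" by (rule Fprop(2))
  show "T \<subseteq> F" if "T \<in> clusters" "T \<inter> F \<noteq> {}" for T using that by (rule Fprop(3))
  have SF: "S \<inter> F = {}" using Fprop(3) S by blast
  let ?Q = "\<lambda>j. j < length Ps \<and> F \<union> S \<in> Ps ! j"
  have "\<exists>j. ?Q j" using S(3) Ps(2) by (auto simp: in_set_conv_nth)
  then obtain j where j: "?Q j" and least: "\<And>j'. j' < j \<Longrightarrow> \<not> ?Q j'"
    using exists_least_iff[of ?Q] by blast
  \<comment> \<open>At stage 0 the set \<open>F \<union> S\<close> would be a single 1-cluster,
    hence equal to \<open>S\<close>, leaving no room for the nonempty \<open>F\<close>.\<close>
  have "j \<noteq> 0"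
  proof
    assume "j = 0"
    then have "F \<union> S \<in> clusters" using j P0 by simp
    then have "F \<union> S = S" using cluster_disjoint[OF _ S(1)] clusterD(2)[OF S(1)] by blast
    then show False using SF Fprop(1) by blast
  qed
  then obtain j' where j': "j = Suc j'" using not0_implies_Suc by blast
  have lt: "j' < length Ps" using j j' by simp
  note part' = part[OF lt, unfolded cluster_partition_def]
  obtain A B where AB: "A \<in> Ps ! j'" "B \<in> Ps ! j'" "A \<noteq> B" "mergeable_12 r A B"
    "Ps ! j = insert (A \<union> B) (Ps ! j' - {A, B})"
    using succ[of j'] j j' unfolding merge_step_def by blast
  have "F \<union> S \<notin> Ps ! j'" using least[of j'] j' lt by simp
  moreover have "F \<union> S \<in> insert (A \<union> B) (Ps ! j' - {A, B})" using j unfolding AB(5) by (rule conjunct2)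
  ultimately have ABFS: "A \<union> B = F \<union> S" by (metis DiffD1 insertE)
  \<comment> \<open>Were \<open>F\<close> a part at stage \<open>j\<close> or later, the part
    containing \<open>F \<union> S\<close> at that stage would meet \<open>F\<close> and so equal
    it, forcing \<open>S \<subseteq> F\<close>.\<close>
  have "i \<le> j'"
  proof (rule ccontr)
    assume "\<not> i \<le> j'"
    then obtain X where X: "X \<in> Ps ! i" "F \<union> S \<subseteq> X" using refine[of j i "F \<union> S"] j j' i by auto
    have "F \<subseteq> X" using X(2) by simp
    then have "X \<inter> F \<noteq> {}" using Fprop(1) by auto
    then have "X = F" using part[OF i(1)] i(2) X(1) unfolding cluster_partition_def by meson
    then show False using X(2) S(2) by blast
  qed
  then obtain X where X: "X \<in> Ps ! j'" "F \<subseteq> X" using refine[of i j' F] lt i by blast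
  have dj: "U = V" if "U \<in> Ps ! j'" "V \<in> Ps ! j'" "U \<inter> V \<noteq> {}" for U V
    using part' that by meson
  obtain e where "e \<in> F" using Fprop(1) by auto
  then have "e \<in> X" "e \<in> A \<or> e \<in> B" using X(2) ABFS by auto
  then have "X = A \<or> X = B" using dj[OF X(1) AB(1)] dj[OF X(1) AB(2)] by auto
  \<comment> \<open>Stated for \<open>U\<close> and \<open>V\<close> to cover both roles of
    \<open>A\<close> and \<open>B\<close>. If \<open>F\<close> lies in \<open>U\<close>, then
    \<open>V\<close> is a nonempty subset of \<open>S\<close>; 1-clusters are not split, so
    \<open>V = S\<close> and \<open>U = F\<close>.\<close>
  moreover have key: "mergeable_12 r F S"
    if U: "U \<in> Ps ! j'" "V \<in> Ps ! j'" "U \<noteq> V" "mergeable_12 r U V" "U \<union> V = F \<union> S" "F \<subseteq> U" for U V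
  proof -
    have UV: "U \<inter> V = {}" using dj[OF U(1,2)] U(3) by auto
    have V: "V \<noteq> {}" "S \<inter> V \<noteq> {} \<Longrightarrow> S \<subseteq> V" using part' U(2) S(1) by simp_all
    have VS: "V \<subseteq> S" using U(5,6) UV by blast
    then have "S \<inter> V \<noteq> {}" using V(1) by auto
    then have "S = V" using V(2) VS by auto
    moreover have "U = F" using U(5,6) UV SF unfolding \<open>S = V\<close> by blast
    ultimately show ?thesis using U(4) by simp
  qed
  ultimately show "mergeable_12 r F S"
    using key[OF AB(1-4) ABFS]
      key[OF AB(2,1) AB(3)[symmetric] sympD[OF symp_mergeable_12 AB(4)] trans[OF Un_commute ABFS]] X(2)
    by blast
qed

end

theorem theorem3p6:
  fixes r k :: nat and G :: "'a set set" and M2 M2' :: "'a set set set" and F :: "'a set set"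
  assumes "r \<ge> 3" and "k \<ge> 3"
    and "r_graph r G" and "bes_free r k G"
    and "two_clustering r G M2 M2'"
    and "F \<in> M2'" and "property_P r k G F"
  shows "\<forall>S\<in>one_clusters G. \<not> S \<subseteq> F \<longrightarrow> F \<union> S \<in> M2' \<longrightarrow>
           card S = 2 \<and> property_P r k G (F \<union> S)"
proof (intro ballI impI)
  fix S assume S: "S \<in> one_clusters G" "\<not> S \<subseteq> F" "F \<union> S \<in> M2'"
  interpret bes_free_graph r k G by unfold_locales (use assms in auto)
  note merge = merged_cluster_mergeable[OF assms(5,6) S]
  show "card S = 2 \<and> property_P r k G (F \<union> S)"
    by (rule property_P_add_cluster[OF assms(7) merge(3,2) S(1,2) merge(1)])
qed

end
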